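(* The infinite-dimensional extension $\mathcal{W}$ of the algebra $\mathfrak{alt}_1\simeq\mathfrak{sl}(2,\mathbb{R})\otimes\mathbb{R}[\varepsilon]/\varepsilon^2$ is a contraction of a pair of commuting Virasoro algebras, $\mathfrak{vir}\oplus\overline{\mathfrak{vir}}\to\mathcal{W}$. In particular, one has the explicit differential operator representation of $\mathcal{W}$ $$L_n=-t^{n+1}\partial_t-(n+1)t^n r\,\partial_r-(n+1)x\,t^n-n(n+1)\gamma\,t^{n-1}r,$$ $$L_n^{\varepsilon}=-t^{n+1}\partial_r-(n+1)\gamma\,t^n,$$ where $x$ and $\gamma$ are parameters and $n\in\mathbb{Z}$.
   Context: $\mathcal{W}=\mathrm{Vect}(S^1)\otimes\mathbb{R}[\varepsilon]/\varepsilon^2$, where $\mathrm{Vect}(S^1)$ is the Lie algebra of vector fields on the circle, is the Lie algebra with basis $(L_n)_{n\in\mathbb{Z}},(L_n^{\varepsilon})_{n\in\mathbb{Z}}$ and brackets $[L_n,L_m]=(n-m)L_{n+m}$, $[L_n,L_m^{\varepsilon}]=(n-m)L_{n+m}^{\varepsilon}$, $[L_n^{\varepsilon},L_m^{\varepsilon}]=0$. It contains $\mathfrak{alt}_1$ (the algebra $\mathfrak{alt}$ for one space dimension, a maximal parabolic subalgebra of the conformal algebra $\mathfrak{conf}_3$) as the span of $L_n,L_n^{\varepsilon}$ with $n\in\{-1,0,1\}$. The Virasoro algebra is $\mathfrak{vir}:=\mathrm{Vect}(S^1)\oplus\mathbb{R}K=\langle(L_n)_{n\in\mathbb{Z}},K\rangle$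 with brackets $[K,L_n]=0$ and $[L_n,L_m]=(n-m)L_{n+m}+\delta_{n+m,0}\,c\,n(n^2-1)K$, where $c\in\mathbb{R}$ is a parameter; for $c=0$ the $L_n$ satisfy the brackets of $\mathrm{Vect}(S^1)$. $\overline{\mathfrak{vir}}$ denotes a second Virasoro algebra commuting with the first. A contraction is meant in the usual sense of Lie algebra theory: the brackets of the contracted algebra are obtained as the limit of the brackets of the original one under a parameter-dependent change of basis that becomes singular in the limit. The operators act on functions of the two variables $t,r$, and their bracket is the commutator. *)

theory Defs
  imports "HOL-Analysis.Analysis" "HOL-Analysis.Finite_Function_Topology"
begin

section \<open>Real Lie algebras\<close>

text \<open>
  A Lie algebra is a carrier subspace of an ambient real vector space together with a bracket;
  the bracket is constrained only on the carrier.
\<close>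

definition lie_algebra :: "'a::real_vector set \<Rightarrow> ('a \<Rightarrow> 'a \<Rightarrow> 'a) \<Rightarrow> bool" where
  "lie_algebra V br \<longleftrightarrow>
     subspace V \<and>
     (\<forall>x\<in>V. \<forall>y\<in>V. br x y \<in> V) \<and>
     (\<forall>x\<in>V. \<forall>y\<in>V. \<forall>z\<in>V. br (x + y) z = br x z + br y z \<and> br z (x + y) = br z x + br z y) \<and>
     (\<forall>s. \<forall>x\<in>V. \<forall>y\<in>V. br (s *\<^sub>R x) y = s *\<^sub>R br x y \<and> br x (s *\<^sub>R y) = s *\<^sub>R br x y) \<and>
     (\<forall>x\<in>V. br x x = 0) \<and>
     (\<forall>x\<in>V. \<forall>y\<in>V. \<forall>z\<in>V. br x (br y z) + br y (br z x) + br z (br x y) = 0)"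

definition lie_subalgebra :: "'a::real_vector set \<Rightarrow> 'a set \<Rightarrow> ('a \<Rightarrow> 'a \<Rightarrow> 'a) \<Rightarrow> bool" where
  "lie_subalgebra U V br \<longleftrightarrow>
     lie_algebra V br \<and> U \<subseteq> V \<and> subspace U \<and> (\<forall>x\<in>U. \<forall>y\<in>U. br x y \<in> U)"

definition lie_isomorphic ::
  "'a::real_vector set \<Rightarrow> ('a \<Rightarrow> 'a \<Rightarrow> 'a) \<Rightarrow> 'b::real_vector set \<Rightarrow> ('b \<Rightarrow> 'b \<Rightarrow> 'b) \<Rightarrow> bool" where
  "lie_isomorphic V brV U brU \<longleftrightarrow>
     lie_algebra V brV \<and> lie_algebra U brU \<and>
     (\<exists>f. linear f \<and> bij_betw f V U \<and> (\<forall>x\<in>V. \<forall>y\<in>V. f (brV x y) = brU (f x) (f y)))"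

definition direct_sum_bracket ::
  "('a \<Rightarrow> 'a \<Rightarrow> 'a) \<Rightarrow> ('b \<Rightarrow> 'b \<Rightarrow> 'b) \<Rightarrow> 'a \<times> 'b \<Rightarrow> 'a \<times> 'b \<Rightarrow> 'a \<times> 'b" where
  "direct_sum_bracket br br' = (\<lambda>(x, x') (y, y'). (br x y, br' x' y'))"

text \<open>
  The bracket of \<open>g \<otimes> \<real>[\<epsilon>]/\<epsilon>\<^sup>2\<close>, where the pair \<open>(x, x')\<close> stands for \<open>x + \<epsilon> x'\<close>.
\<close>

definition dual_bracket ::
  "('a::plus \<Rightarrow> 'a \<Rightarrow> 'a) \<Rightarrow> 'a \<times> 'a \<Rightarrow> 'a \<times> 'a \<Rightarrow> 'a \<times> 'a" where
  "dual_bracket br = (\<lambda>(x, x') (y, y'). (br x y, br x y' + br x' y))"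

definition sl2 :: "(real^2^2) set" where
  "sl2 = {A. trace A = 0}"

definition commutator :: "real^2^2 \<Rightarrow> real^2^2 \<Rightarrow> real^2^2" where
  "commutator A B = A ** B - B ** A"


section \<open>Contractions\<close>

text \<open>
  The bracket \<open>brh\<close> is a contraction of \<open>brg\<close>. The maps \<open>\<phi> a\<close> (\<open>a > 0\<close>) are the
  change of basis, depending continuously on \<open>a\<close>: if \<open>e\<^sub>i\<close> is a basis of the contracted algebra, then \<open>\<phi> a e\<^sub>i\<close> is a
  basis of the original one, and the transported bracket on the left of the arrow collects the
  structure constants of the original algebra in that basis. As \<open>a\<close> tends to 0 these converge
  to the contracted bracket, while the basis vectors converge to linearly dependent vectors.
\<close>

definition is_contraction ::
  "('g::real_normed_vector \<Rightarrow> 'g \<Rightarrow> 'g) \<Rightarrow> ('h::real_normed_vector \<Rightarrow> 'h \<Rightarrow> 'h) \<Rightarrow> bool" where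
  "is_contraction brg brh \<longleftrightarrow>
     lie_algebra UNIV brg \<and> lie_algebra UNIV brh \<and>
     (\<exists>\<phi> :: real \<Rightarrow> 'h \<Rightarrow> 'g.
        (\<forall>a>0. linear (\<phi> a) \<and> bij (\<phi> a)) \<and>
        (\<forall>x. continuous_on {0<..} (\<lambda>a. \<phi> a x)) \<and>
        (\<forall>x y. ((\<lambda>a. inv (\<phi> a) (brg (\<phi> a x) (\<phi> a y))) \<longlongrightarrow> brh x y) (at_right 0)) \<and>
        (\<exists>\<phi>0. (\<forall>x. ((\<lambda>a. \<phi> a x) \<longlongrightarrow> \<phi>0 x) (at_right 0)) \<and> \<not> inj \<phi>0))"


section \<open>Lie algebras given by a basis\<close>

text \<open>
  The real vector space with basis \<open>'b\<close> is the type \<open>'b \<Rightarrow>\<^sub>0 real\<close> of finitely supported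
  functions, normed in the library by the sum of the absolute values of the coefficients.
  In particular, convergence there implies convergence of every coefficient.
\<close>

abbreviation basis_vec :: "'b \<Rightarrow> ('b \<Rightarrow>\<^sub>0 real)" where
  "basis_vec b \<equiv> Poly_Mapping.single b 1"

definition lin_ext :: "('b \<Rightarrow> 'v) \<Rightarrow> ('b \<Rightarrow>\<^sub>0 real) \<Rightarrow> 'v::real_vector" where
  "lin_ext f x = (\<Sum>b\<in>Poly_Mapping.keys x. Poly_Mapping.lookup x b *\<^sub>R f b)"

definition bilin_ext ::
  "('b \<Rightarrow> 'b \<Rightarrow> 'b \<Rightarrow>\<^sub>0 real) \<Rightarrow> ('b \<Rightarrow>\<^sub>0 real) \<Rightarrow> ('b \<Rightarrow>\<^sub>0 real) \<Rightarrow> ('b \<Rightarrow>\<^sub>0 real)" where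
  "bilin_ext s x y = lin_ext (\<lambda>b. lin_ext (s b) y) x"

datatype W_basis = W_L int | W_Leps int

fun W_table :: "W_basis \<Rightarrow> W_basis \<Rightarrow> W_basis \<Rightarrow>\<^sub>0 real" where
  "W_table (W_L n) (W_L m) = real_of_int (n - m) *\<^sub>R basis_vec (W_L (n + m))"
| "W_table (W_L n) (W_Leps m) = real_of_int (n - m) *\<^sub>R basis_vec (W_Leps (n + m))"
| "W_table (W_Leps n) (W_L m) = - (real_of_int (m - n) *\<^sub>R basis_vec (W_Leps (m + n)))"
| "W_table (W_Leps n) (W_Leps m) = 0"

definition W_bracket :: "(W_basis \<Rightarrow>\<^sub>0 real) \<Rightarrow> (W_basis \<Rightarrow>\<^sub>0 real) \<Rightarrow> (W_basis \<Rightarrow>\<^sub>0 real)" where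
  "W_bracket = bilin_ext W_table"

definition alt1 :: "(W_basis \<Rightarrow>\<^sub>0 real) set" where
  "alt1 = span ((\<lambda>n. basis_vec (W_L n)) ` {-1, 0, 1} \<union> (\<lambda>n. basis_vec (W_Leps n)) ` {-1, 0, 1})"

datatype vir_basis = Vir_L int | Vir_K

fun vir_table :: "real \<Rightarrow> vir_basis \<Rightarrow> vir_basis \<Rightarrow> vir_basis \<Rightarrow>\<^sub>0 real" where
  "vir_table c (Vir_L n) (Vir_L m) =
     real_of_int (n - m) *\<^sub>R basis_vec (Vir_L (n + m)) +
     (if n + m = 0 then c * real_of_int (n * (n^2 - 1)) else 0) *\<^sub>R basis_vec Vir_K"
| "vir_table c (Vir_L n) Vir_K = 0"
| "vir_table c Vir_K b = 0"

definition vir_bracket ::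
  "real \<Rightarrow> (vir_basis \<Rightarrow>\<^sub>0 real) \<Rightarrow> (vir_basis \<Rightarrow>\<^sub>0 real) \<Rightarrow> (vir_basis \<Rightarrow>\<^sub>0 real)" where
  "vir_bracket c = bilin_ext (vir_table c)"


section \<open>Differential operators in \<open>t\<close> and \<open>r\<close>\<close>

definition d_t :: "(real \<times> real \<Rightarrow> real) \<Rightarrow> real \<times> real \<Rightarrow> real" where
  "d_t f = (\<lambda>(t, r). deriv (\<lambda>s. f (s, r)) t)"

definition d_r :: "(real \<times> real \<Rightarrow> real) \<Rightarrow> real \<times> real \<Rightarrow> real" where
  "d_r f = (\<lambda>(t, r). deriv (\<lambda>s. f (t, s)) r)"

primrec C_times :: "nat \<Rightarrow> (real \<times> real) set \<Rightarrow> (real \<times> real \<Rightarrow> real) \<Rightarrow> bool" where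
  "C_times 0 D f \<longleftrightarrow> continuous_on D f"
| "C_times (Suc k) D f \<longleftrightarrow>
     (\<forall>p\<in>D. f differentiable (at p)) \<and> C_times k D (d_t f) \<and> C_times k D (d_r f)"

definition smooth_fun :: "(real \<times> real) set \<Rightarrow> (real \<times> real \<Rightarrow> real) \<Rightarrow> bool" where
  "smooth_fun D f \<longleftrightarrow> (\<forall>k. C_times k D f)"

text \<open>
  A representation \<open>\<rho>\<close> of a Lie algebra (with bracket \<open>br\<close>) by linear operators on the smooth
  functions on the open set \<open>D\<close>. Such a function is represented by a total function whose values
  outside \<open>D\<close> are irrelevant, so all identities are required on \<open>D\<close> only, and the operators
  must respect equality on \<open>D\<close>.
\<close>

definition smooth_representation ::
  "(real \<times> real) set \<Rightarrow> ('a::real_vector \<Rightarrow> 'a \<Rightarrow> 'a) \<Rightarrow>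
   ('a \<Rightarrow> (real \<times> real \<Rightarrow> real) \<Rightarrow> (real \<times> real \<Rightarrow> real)) \<Rightarrow> bool" where
  "smooth_representation D br \<rho> \<longleftrightarrow>
     open D \<and> lie_algebra UNIV br \<and>
     (\<forall>u f. smooth_fun D f \<longrightarrow> smooth_fun D (\<rho> u f)) \<and>
     (\<forall>u f g. smooth_fun D f \<longrightarrow> (\<forall>p\<in>D. f p = g p) \<longrightarrow> (\<forall>p\<in>D. \<rho> u f p = \<rho> u g p)) \<and>
     (\<forall>u f g s. smooth_fun D f \<longrightarrow> smooth_fun D g \<longrightarrow>
        (\<forall>p\<in>D. \<rho> u (\<lambda>q. f q + s * g q) p = \<rho> u f p + s * \<rho> u g p)) \<and>
     (\<forall>u v s f. smooth_fun D f \<longrightarrow>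
        (\<forall>p\<in>D. \<rho> (u + s *\<^sub>R v) f p = \<rho> u f p + s * \<rho> v f p)) \<and>
     (\<forall>u v f. smooth_fun D f \<longrightarrow>
        (\<forall>p\<in>D. \<rho> (br u v) f p = \<rho> u (\<rho> v f) p - \<rho> v (\<rho> u f) p))"

fun W_op :: "real \<Rightarrow> real \<Rightarrow> W_basis \<Rightarrow> (real \<times> real \<Rightarrow> real) \<Rightarrow> real \<times> real \<Rightarrow> real" where
  "W_op x \<gamma> (W_L n) f (t, r) =
     - (t powi (n + 1)) * d_t f (t, r)
     - real_of_int (n + 1) * t powi n * r * d_r f (t, r)
     - real_of_int (n + 1) * x * t powi n * f (t, r)
     - real_of_int (n * (n + 1)) * \<gamma> * t powi (n - 1) * r * f (t, r)"
| "W_op x \<gamma> (W_Leps n) f (t, r) =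
     - (t powi (n + 1)) * d_r f (t, r)
     - real_of_int (n + 1) * \<gamma> * t powi n * f (t, r)"

definition W_rep ::
  "real \<Rightarrow> real \<Rightarrow> (W_basis \<Rightarrow>\<^sub>0 real) \<Rightarrow> (real \<times> real \<Rightarrow> real) \<Rightarrow> real \<times> real \<Rightarrow> real" where
  "W_rep x \<gamma> w f p = lin_ext (\<lambda>b. W_op x \<gamma> b f p) w"

end

theory Submission
  imports Defs
begin

text \<open>
  The contraction sends \<open>L\<^sub>n\<close> to \<open>L\<^sub>n + Lbar\<^sub>n\<close> and \<open>L\<^sub>n\<^sup>\<epsilon>\<close> to \<open>a (L\<^sub>n - Lbar\<^sub>n)\<close>, but this misses the two
  central elements, while the change of basis has to be bijective for every \<open>a > 0\<close>. As in Hilbert's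
  hotel, each of the families \<open>L\<^sub>n\<close>, \<open>L\<^sub>n\<^sup>\<epsilon>\<close> makes room for one central element at the index
  \<open>N = \<lfloor>1/a\<rfloor>\<close>: the indices beyond \<open>N + 1\<close> are shifted down by one, and a rotation in the plane of the
  indices \<open>N\<close> and \<open>N + 1\<close> interpolates continuously between consecutive values of \<open>N\<close>. For every
  fixed index this has no effect once \<open>a\<close> is small. Scaling the central elements by \<open>1/a\<close> makes
  their contribution to the structure constants vanish in the limit.

  For the representation, the commutator of two first-order operators is again of first order
  because the mixed second derivatives agree, and its coefficients are compared on basis elements.
\<close>

section \<open>Lie algebras given by structure constants\<close>

lemma lookup_scaleR [simp]:
  "Poly_Mapping.lookup (s *\<^sub>R x) b = s *\<^sub>R Poly_Mapping.lookup x b"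
proof -
  have "finite {i. s *\<^sub>R Poly_Mapping.lookup x i \<noteq> 0}"
    by (rule finite_subset[OF _ finite_keys[of x]]) (auto simp: in_keys_iff)
  then show ?thesis
    by (simp add: scaleR_poly_mapping_def)
qed

text \<open>Coefficients off the support vanish, so two vectors with different supports can be
  summed over one common finite index set.\<close>

lemma lin_ext_superset:
  assumes "finite A" "Poly_Mapping.keys x \<subseteq> A"
  shows "lin_ext f x = (\<Sum>b\<in>A. Poly_Mapping.lookup x b *\<^sub>R f b)"
  unfolding lin_ext_def using assms
  by (intro sum.mono_neutral_left) (auto simp: in_keys_iff)

lemma linear_lin_ext: "linear (lin_ext f)"
proof (rule linearI)
  fix x y :: "'a \<Rightarrow>\<^sub>0 real" and s :: real
  let ?A = "Poly_Mapping.keys x \<union> Poly_Mapping.keys y"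
  have *: "lin_ext f z = (\<Sum>b\<in>?A. Poly_Mapping.lookup z b *\<^sub>R f b)"
    if "Poly_Mapping.keys z \<subseteq> ?A" for z
    using that by (intro lin_ext_superset) auto
  show "lin_ext f (x + y) = lin_ext f x + lin_ext f y"
    by (simp add: * Poly_Mapping.keys_add lookup_add scaleR_add_left sum.distrib)
  have "Poly_Mapping.keys (s *\<^sub>R x) \<subseteq> ?A"
    by (auto simp: in_keys_iff)
  then show "lin_ext f (s *\<^sub>R x) = s *\<^sub>R lin_ext f x"
    by (simp add: * scaleR_sum_right)
qed

lemma lin_ext_single [simp]: "lin_ext f (Poly_Mapping.single b r) = r *\<^sub>R f b"
  by (simp add: lin_ext_def)

lemma lin_ext_basis_vec: "lin_ext basis_vec x = x"
proof (rule poly_mapping_eqI)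
  fix k
  have "Poly_Mapping.lookup (lin_ext basis_vec x) k =
      (\<Sum>b\<in>Poly_Mapping.keys x. if b = k then Poly_Mapping.lookup x b else 0)"
    unfolding lin_ext_def lookup_sum lookup_scaleR
    by (intro sum.cong refl) (auto simp: lookup_single)
  also have "\<dots> = Poly_Mapping.lookup x k"
    by (auto simp: in_keys_iff)
  finally show "Poly_Mapping.lookup (lin_ext basis_vec x) k = Poly_Mapping.lookup x k" .
qed

lemma linear_eq_lin_ext:
  assumes "linear f"
  shows "f x = lin_ext (\<lambda>b. f (basis_vec b)) x"
proof -
  have "f x = f (lin_ext basis_vec x)"
    by (simp only: lin_ext_basis_vec)
  also have "\<dots> = lin_ext (\<lambda>b. f (basis_vec b)) x"
    unfolding lin_ext_def by (simp add: linear_sum[OF assms] linear_scale[OF assms])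
  finally show ?thesis .
qed

lemma linear_eq_on_basis:
  assumes "linear f" "linear g" "\<And>b. f (basis_vec b) = g (basis_vec b)"
  shows "f x = g x"
  unfolding linear_eq_lin_ext[OF assms(1), of x] linear_eq_lin_ext[OF assms(2), of x] assms(3) ..

lemma bilinear_eq_on_basis:
  assumes "bilinear f" "bilinear g"
    and "\<And>b b'. f (basis_vec b) (basis_vec b') = g (basis_vec b) (basis_vec b')"
  shows "f x y = g x y"
proof -
  have l: "linear (f u)" "linear (\<lambda>u. f u v)" "linear (g u)" "linear (\<lambda>u. g u v)" for u v
    using assms(1,2) unfolding bilinear_def by blast+
  have "f (basis_vec b) y = g (basis_vec b) y" for b
    by (rule linear_eq_on_basis[OF l(1) l(3) assms(3)])
  then show ?thesis
    by (rule linear_eq_on_basis[OF l(2) l(4)])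
qed

lemma lin_ext_add_fun: "lin_ext (\<lambda>b. f b + g b) x = lin_ext f x + lin_ext g x"
  by (simp add: lin_ext_def scaleR_add_right sum.distrib)

lemma lin_ext_scaleR_fun: "lin_ext (\<lambda>b. s *\<^sub>R f b) x = s *\<^sub>R lin_ext f x"
  by (simp add: lin_ext_def scaleR_sum_right mult.commute)

lemma bilinear_bilin_ext: "bilinear (bilin_ext s)"
  unfolding bilinear_def bilin_ext_def
  by (auto intro!: linearI simp: linear_add[OF linear_lin_ext] linear_scale[OF linear_lin_ext]
        lin_ext_add_fun lin_ext_scaleR_fun)

lemma bilin_ext_basis_vec [simp]: "bilin_ext s (basis_vec b) (basis_vec b') = s b b'"
  by (simp add: bilin_ext_def)

text \<open>Antisymmetry and the Jacobi identity are linear in every argument, so checking them on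
  basis vectors suffices. The hypothesis \<open>jacobi\<close> has its inner brackets already
  evaluated to table entries, which is the form the concrete tables provide.\<close>

lemma lie_algebra_bilin_ext:
  fixes s :: "'b \<Rightarrow> 'b \<Rightarrow> 'b \<Rightarrow>\<^sub>0 real"
  assumes anti: "\<And>a b. s a b = - s b a"
    and jacobi: "\<And>a b c. bilin_ext s (basis_vec a) (s b c) + bilin_ext s (basis_vec b) (s c a)
                   + bilin_ext s (basis_vec c) (s a b) = 0"
  shows "lie_algebra UNIV (bilin_ext s)"
proof -
  define br where "br = bilin_ext s"
  have bil: "bilinear br"
    unfolding br_def by (rule bilinear_bilin_ext)
  note br_simps = bilinear_ladd[OF bil] bilinear_radd[OF bil] bilinear_lmul[OF bil] bilinear_rmul[OF bil]
  have anti': "br x y = - br y x" for x y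
  proof (rule bilinear_eq_on_basis[of br "\<lambda>x y. - br y x"])
    show "bilinear (\<lambda>x y. - br y x)"
      by (simp add: bilinear_def linear_iff br_simps)
    show "br (basis_vec b) (basis_vec b') = - br (basis_vec b') (basis_vec b)" for b b'
      unfolding br_def bilin_ext_basis_vec by (rule anti)
  qed (rule bil)
  have alt: "br x x = 0" for x
  proof -
    \<comment> \<open>Antisymmetry says that \<open>br x x\<close> is its own negative; over the
      reals the factor 2 can be divided out.\<close>
    have "2 *\<^sub>R br x x = br x x + br x x"
      by (rule scaleR_2)
    also have "\<dots> = 0"
      by (subst anti') simp
    finally show ?thesis by simp
  qed
  \<comment> \<open>The Jacobi sum is trilinear, so its vanishing spreads from basis triples one
    argument at a time, beginning with the last.\<close>
  define J where "J x y z = br x (br y z) + br y (br z x) + br z (br x y)" for x y z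
  have lin: "linear (\<lambda>x. J x y z)" "linear (\<lambda>y. J x y z)" "linear (\<lambda>z. J x y z)" for x y z
    by (auto simp: J_def linear_iff br_simps scaleR_add_right add_ac)
  have "J (basis_vec a) (basis_vec b) (basis_vec d) = 0" for a b d
    using jacobi[of a b d] by (simp add: J_def br_def)
  then have "J (basis_vec a) (basis_vec b) z = 0" for a b z
    by (rule linear_eq_on_basis[OF lin(3) linear_zero])
  then have "J (basis_vec a) y z = 0" for a y z
    by (rule linear_eq_on_basis[OF lin(2) linear_zero])
  then have jac: "J x y z = 0" for x y z
    by (rule linear_eq_on_basis[OF lin(1) linear_zero])
  show ?thesis
    unfolding lie_algebra_def br_def[symmetric]
    using alt jac[unfolded J_def] by (auto simp: br_simps)
qed

section \<open>The brackets of W and of the Virasoro algebra\<close>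

lemma bilinear_W_bracket: "bilinear W_bracket"
  unfolding W_bracket_def by (rule bilinear_bilin_ext)

lemma W_bracket_basis_vec [simp]: "W_bracket (basis_vec b) (basis_vec b') = W_table b b'"
  by (simp add: W_bracket_def)

lemma lie_algebra_W_bracket: "lie_algebra UNIV W_bracket"
  unfolding W_bracket_def
proof (rule lie_algebra_bilin_ext)
  note br = bilinear_rmul[OF bilinear_W_bracket] bilinear_rneg[OF bilinear_W_bracket]
    bilinear_rzero[OF bilinear_W_bracket] W_bracket_def[symmetric]
  show "W_table a b = - W_table b a" for a b
    by (cases a; cases b) (simp_all add: add.commute flip: scaleR_minus_left)
  show "bilin_ext W_table (basis_vec a) (W_table b d) + bilin_ext W_table (basis_vec b) (W_table d a)
      + bilin_ext W_table (basis_vec d) (W_table a b) = 0" for a b d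
    \<comment> \<open>In each case all terms share one basis vector, whose index is the sum of the
      three indices. Once the coefficients are collected, a polynomial identity in the indices
      remains.\<close>
    by (cases a; cases b; cases d)
       (simp_all add: br add_ac flip: scaleR_add_left scaleR_minus_left scaleR_diff_left,
        simp_all add: algebra_simps)
qed

lemma bilinear_vir_bracket: "bilinear (vir_bracket c)"
  unfolding vir_bracket_def by (rule bilinear_bilin_ext)

lemma vir_bracket_basis_vec [simp]: "vir_bracket c (basis_vec b) (basis_vec b') = vir_table c b b'"
  by (simp add: vir_bracket_def)

lemma vir_table_K_right [simp]: "vir_table c b Vir_K = 0"
  by (cases b) simp_all

text \<open>The central term is a 2-cocycle: \<open>p * (p^2 - 1)\<close> is odd in
  \<open>p\<close>, which gives antisymmetry, and its cyclic sum vanishes on indices of total 0,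
  which gives the Jacobi identity.\<close>

lemma lie_algebra_vir_bracket: "lie_algebra UNIV (vir_bracket c)"
  unfolding vir_bracket_def
proof (rule lie_algebra_bilin_ext)
  note br = bilinear_rmul[OF bilinear_vir_bracket] bilinear_radd[OF bilinear_vir_bracket]
    bilinear_rzero[OF bilinear_vir_bracket]
  define Z where "Z p q = (if p + q = 0 then c * real_of_int (p * (p^2 - 1)) else 0)" for p q :: int
  have table: "vir_table c (Vir_L p) (Vir_L q) =
      real_of_int (p - q) *\<^sub>R basis_vec (Vir_L (p + q)) + Z p q *\<^sub>R basis_vec Vir_K" for p q
    by (simp add: Z_def)
  show "vir_table c a b = - vir_table c b a" for a b
  proof (cases a; cases b)
    fix n m assume ab: "a = Vir_L n" "b = Vir_L m"
    have Z: "Z n m = - Z m n"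
      by (auto simp: Z_def add_eq_0_iff2)
    show ?thesis
      unfolding ab table Z add.commute[of m n] by (simp add: algebra_simps)
  qed auto
  show "bilin_ext (vir_table c) (basis_vec a) (vir_table c b d)
      + bilin_ext (vir_table c) (basis_vec b) (vir_table c d a)
      + bilin_ext (vir_table c) (basis_vec d) (vir_table c a b) = 0" for a b d
  proof (cases a; cases b; cases d)
    fix n m k assume abd: "a = Vir_L n" "b = Vir_L m" "d = Vir_L k"
    have *: "vir_bracket c (basis_vec (Vir_L p)) (vir_table c (Vir_L q) (Vir_L r)) =
       (real_of_int (q - r) * real_of_int (p - (q + r))) *\<^sub>R basis_vec (Vir_L (p + (q + r))) +
       (real_of_int (q - r) * Z p (q + r)) *\<^sub>R basis_vec Vir_K" for p q r
      unfolding table br vir_bracket_basis_vec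
      by (simp only: table vir_table_K_right scaleR_zero_right add_0_right scaleR_add_right scaleR_scaleR)
    \<comment> \<open>The Jacobi sum has two coordinates: \<open>1\<close> is the coefficient of
      \<open>Vir_L (n + m + k)\<close> and \<open>2\<close> that of \<open>Vir_K\<close>.\<close>
    have 1: "real_of_int (m - k) * real_of_int (n - (m + k)) + real_of_int (k - n) * real_of_int (m - (k + n))
       + real_of_int (n - m) * real_of_int (k - (n + m)) = 0"
      by (simp add: algebra_simps)
    have 2: "real_of_int (m - k) * Z n (m + k) + real_of_int (k - n) * Z m (k + n)
       + real_of_int (n - m) * Z k (n + m) = 0"
    \<comment> \<open>All three values of \<open>Z\<close> carry this same condition, so off the
      hyperplane every term is 0, and on it \<open>k\<close> can be eliminated.\<close>
    proof (cases "n + m + k = 0")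
      case True
      then have k: "k = - n - m" by simp
      show ?thesis unfolding k Z_def
        by (simp add: algebra_simps power2_eq_square)
    next
      case False
      then have "n + (m + k) \<noteq> 0" "m + (k + n) \<noteq> 0" "k + (n + m) \<noteq> 0" by auto
      then show ?thesis unfolding Z_def by (simp only: if_False mult_zero_right add_0_right)
    qed
    have eqs: "n + (m + k) = n + m + k" "m + (k + n) = n + m + k" "k + (n + m) = n + m + k" by auto
    have comb: "(p *\<^sub>R u + q *\<^sub>R v) + (p' *\<^sub>R u + q' *\<^sub>R v) + (p'' *\<^sub>R u + q'' *\<^sub>R v) =
      (p + p' + p'') *\<^sub>R u + (q + q' + q'') *\<^sub>R v" for p p' p'' q q' q'' :: real and u v :: "vir_basis \<Rightarrow>\<^sub>0 real"
      by (simp add: scaleR_add_left)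
    show ?thesis
      unfolding abd vir_bracket_def[symmetric] * eqs comb
      unfolding eqs[symmetric] 1 2 by simp
  qed (auto simp: br vir_bracket_def[symmetric])
qed

section \<open>Direct sums and dual numbers\<close>

lemma lie_algebra_direct_sum:
  assumes "lie_algebra UNIV br" "lie_algebra UNIV br'"
  shows "lie_algebra UNIV (direct_sum_bracket br br')"
  using assms by (auto simp: lie_algebra_def direct_sum_bracket_def zero_prod_def)

text \<open>Each law is compared in the powers of eps. The eps part of
  \<open>dual_bracket br p p\<close> is the symmetrised bracket, zero by polarisation
  (\<open>anti\<close>); the eps part of the Jacobi sum is treated in \<open>jac'\<close>.\<close>

lemma lie_algebra_dual:
  assumes "lie_algebra V br"
  shows "lie_algebra (V \<times> V) (dual_bracket br)"
proof -
  have V: "subspace V" and cl: "\<And>x y. x \<in> V \<Longrightarrow> y \<in> V \<Longrightarrow> br x y \<in> V"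
    and ladd: "\<And>x y z. x \<in> V \<Longrightarrow> y \<in> V \<Longrightarrow> z \<in> V \<Longrightarrow> br (x + y) z = br x z + br y z"
    and radd: "\<And>x y z. x \<in> V \<Longrightarrow> y \<in> V \<Longrightarrow> z \<in> V \<Longrightarrow> br z (x + y) = br z x + br z y"
    and lsc: "\<And>s x y. x \<in> V \<Longrightarrow> y \<in> V \<Longrightarrow> br (s *\<^sub>R x) y = s *\<^sub>R br x y"
    and rsc: "\<And>s x y. x \<in> V \<Longrightarrow> y \<in> V \<Longrightarrow> br x (s *\<^sub>R y) = s *\<^sub>R br x y"
    and alt: "\<And>x. x \<in> V \<Longrightarrow> br x x = 0"
    and jac: "\<And>x y z. x \<in> V \<Longrightarrow> y \<in> V \<Longrightarrow> z \<in> V \<Longrightarrow> br x (br y z) + br y (br z x) + br z (br x y) = 0"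
    using assms unfolding lie_algebra_def by blast+
  have V_add: "x + y \<in> V" if "x \<in> V" "y \<in> V" for x y
    using V that by (simp add: subspace_add)
  have anti: "br x y + br y x = 0" if "x \<in> V" "y \<in> V" for x y
  proof -
    have "br (x + y) (x + y) = br x y + br y x"
      using that by (simp add: V_add ladd radd alt[OF that(1)] alt[OF that(2)])
    then show ?thesis
      using that by (simp add: alt V_add)
  qed
  have jac': "br x (br y z' + br y' z) + br x' (br y z) + (br y (br z x' + br z' x) + br y' (br z x))
        + (br z (br x y' + br x' y) + br z' (br x y)) = 0" (is "?J = 0")
    if "x \<in> V" "y \<in> V" "z \<in> V" "x' \<in> V" "y' \<in> V" "z' \<in> V" for x y z x' y' z'
  proof -
    \<comment> \<open>By the product rule exactly one of the three arguments contributes its eps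
      part, so the sum regroups into three Jacobi sums of \<open>br\<close>.\<close>
    have "?J = (br x (br y z') + br y (br z' x) + br z' (br x y))
      + (br x (br y' z) + br y' (br z x) + br z (br x y'))
      + (br x' (br y z) + br y (br z x') + br z (br x' y))"
      using that by (simp add: radd cl add_ac)
    then show ?thesis using that by (simp add: jac)
  qed
  have "dual_bracket br p (dual_bracket br q r) + dual_bracket br q (dual_bracket br r p)
      + dual_bracket br r (dual_bracket br p q) = 0" if "p \<in> V \<times> V" "q \<in> V \<times> V" "r \<in> V \<times> V" for p q r
    using that by (cases p; cases q; cases r) (simp add: dual_bracket_def jac jac' zero_prod_def)
  moreover have "dual_bracket br p p = 0" if "p \<in> V \<times> V" for p
    using that by (cases p) (simp add: dual_bracket_def alt anti zero_prod_def)
  ultimately show ?thesis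
    unfolding lie_algebra_def using subspace_Times[OF V V]
    by (auto simp: dual_bracket_def cl V_add ladd radd lsc rsc scaleR_add_right)
qed

section \<open>The subalgebra of W spanned by the indices -1, 0, 1\<close>

lemma bilinear_mem_span:
  assumes "bilinear br" "x \<in> span S" "y \<in> span T" "\<And>a b. a \<in> S \<Longrightarrow> b \<in> T \<Longrightarrow> br a b \<in> span U"
  shows "br x y \<in> span U"
  using assms(2)
proof (induction rule: span_induct_alt)
  case base
  show ?case
    by (simp add: bilinear_lzero[OF assms(1)] span_zero)
next
  case (step s a z)
  have "br a y \<in> span U"
    using assms(3)
  proof (induction rule: span_induct_alt)
    case base
    show ?case
      by (simp add: bilinear_rzero[OF assms(1)] span_zero)
  next
    case (step r b w)
    then show ?case
      using assms(4)[OF \<open>a \<in> S\<close>]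
      by (simp add: bilinear_radd[OF assms(1)] bilinear_rmul[OF assms(1)] span_add span_scale)
  qed
  then show ?case
    using step by (simp add: bilinear_ladd[OF assms(1)] bilinear_lmul[OF assms(1)] span_add span_scale)
qed

abbreviation alt1_basis :: "(W_basis \<Rightarrow>\<^sub>0 real) set" where
  "alt1_basis \<equiv> (\<lambda>n. basis_vec (W_L n)) ` {-1, 0, 1} \<union> (\<lambda>n. basis_vec (W_Leps n)) ` {-1, 0, 1}"

lemma subspace_alt1: "subspace alt1"
  by (simp only: alt1_def subspace_span)

lemma basis_vec_mem_alt1:
  assumes "n \<in> {-1, 0, 1}"
  shows "basis_vec (W_L n) \<in> alt1" "basis_vec (W_Leps n) \<in> alt1"
  using assms unfolding alt1_def by (intro span_base; blast)+

text \<open>The index sum \<open>n + m\<close> leaves the range only for \<open>n = m = 1\<close>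
  and \<open>n = m = -1\<close>, and there the coefficient \<open>n - m\<close> is 0.\<close>

lemma lie_subalgebra_alt1: "lie_subalgebra alt1 UNIV W_bracket"
proof -
  have "W_bracket x y \<in> alt1" if "x \<in> alt1" "y \<in> alt1" for x y
    unfolding alt1_def
  proof (rule bilinear_mem_span[OF bilinear_W_bracket that[unfolded alt1_def]])
    fix a b assume ab: "a \<in> alt1_basis" "b \<in> alt1_basis"
    then show "W_bracket a b \<in> span alt1_basis"
      unfolding alt1_def[symmetric]
      by (auto simp: subspace_0 subspace_scale subspace_neg subspace_alt1 basis_vec_mem_alt1)
  qed
  then show ?thesis
    by (simp add: lie_subalgebra_def lie_algebra_W_bracket alt1_def)
qed

lemma lie_algebra_subalgebra:
  assumes "lie_subalgebra U V br"
  shows "lie_algebra U br"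
  using assms unfolding lie_subalgebra_def lie_algebra_def by (auto simp: subset_iff)

section \<open>The isomorphism with sl(2) over the dual numbers\<close>

lemma trace_2: "trace (A :: real^2^2) = A $ 1 $ 1 + A $ 2 $ 2"
  by (simp add: trace_def sum_2)

lemma bilinear_commutator: "bilinear commutator"
  unfolding bilinear_def commutator_def
  by (auto intro!: linearI simp: algebra_simps vec_eq_iff matrix_matrix_mult_def sum_2)

lemma lie_algebra_sl2: "lie_algebra sl2 commutator"
proof -
  note simps = bilinear_ladd[OF bilinear_commutator] bilinear_radd[OF bilinear_commutator]
    bilinear_lmul[OF bilinear_commutator] bilinear_rmul[OF bilinear_commutator]
  have "subspace sl2"
    by (auto simp: subspace_def sl2_def trace_2 algebra_simps simp flip: distrib_left)
  moreover have "commutator A B \<in> sl2" for A B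
    by (simp add: sl2_def trace_2 commutator_def matrix_matrix_mult_def sum_2)
  moreover have "commutator A (commutator B C) + commutator B (commutator C A)
      + commutator C (commutator A B) = 0" for A B C
    by (simp add: commutator_def vec_eq_iff forall_2 matrix_matrix_mult_def sum_2 algebra_simps)
  moreover have "commutator A A = 0" for A
    by (simp add: commutator_def)
  ultimately show ?thesis
    by (simp add: lie_algebra_def simps)
qed

text \<open>In terms of the standard basis e, h, f these are e, h/2 and -f, normalised to satisfy
  the bracket \<open>(n - m)\<close> of the L_n. The default 0 makes
  \<open>alt1_to_sl2_basis\<close> total on the basis of W.\<close>

definition sl2_vec :: "int \<Rightarrow> real^2^2" where
  "sl2_vec n =
     (if n = -1 then vector [vector [0, 1], vector [0, 0]]
      else if n = 0 then vector [vector [1/2, 0], vector [0, -1/2]]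
      else if n = 1 then vector [vector [0, 0], vector [-1, 0]]
      else 0)"

fun alt1_to_sl2_basis :: "W_basis \<Rightarrow> (real^2^2) \<times> (real^2^2)" where
  "alt1_to_sl2_basis (W_L n) = (sl2_vec n, 0)"
| "alt1_to_sl2_basis (W_Leps n) = (0, sl2_vec n)"

text \<open>Coordinates of traceless matrices with respect to e, h/2 and -f, which explains the
  factor 2 on the diagonal and the sign in the lower left entry.\<close>

definition sl2_to_alt1 :: "(real^2^2) \<times> (real^2^2) \<Rightarrow> W_basis \<Rightarrow>\<^sub>0 real" where
  "sl2_to_alt1 = (\<lambda>(A, B).
     (A $ 1 $ 2) *\<^sub>R basis_vec (W_L (-1)) + (2 * A $ 1 $ 1) *\<^sub>R basis_vec (W_L 0)
       + (- A $ 2 $ 1) *\<^sub>R basis_vec (W_L 1)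
     + (B $ 1 $ 2) *\<^sub>R basis_vec (W_Leps (-1)) + (2 * B $ 1 $ 1) *\<^sub>R basis_vec (W_Leps 0)
       + (- B $ 2 $ 1) *\<^sub>R basis_vec (W_Leps 1))"

lemma sl2_vec_commutator:
  assumes "n \<in> {-1, 0, 1}" "m \<in> {-1, 0, 1}"
  shows "commutator (sl2_vec n) (sl2_vec m) = real_of_int (n - m) *\<^sub>R sl2_vec (n + m)"
  using assms
  by (auto simp: sl2_vec_def commutator_def vec_eq_iff forall_2 matrix_matrix_mult_def sum_2)

lemma lie_isomorphic_alt1_sl2:
  "lie_isomorphic alt1 W_bracket (sl2 \<times> sl2) (dual_bracket commutator)"
proof -
  let ?f = "lin_ext alt1_to_sl2_basis"
  have lin: "linear ?f"
    by (rule linear_lin_ext)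
  have lin': "linear sl2_to_alt1"
    by (auto simp: sl2_to_alt1_def linear_iff scaleR_add_left scaleR_add_right algebra_simps)
  have sub: "subspace (sl2 \<times> sl2)"
    using lie_algebra_sl2 by (simp add: lie_algebra_def subspace_Times)
  have "?f x \<in> sl2 \<times> sl2" if "x \<in> alt1" for x
  proof -
    have "?f ` alt1_basis \<subseteq> sl2 \<times> sl2"
      by (auto simp: sl2_def sl2_vec_def trace_2)
    then have "span (?f ` alt1_basis) \<subseteq> sl2 \<times> sl2"
      by (rule span_minimal[OF _ sub])
    then show ?thesis
      using that unfolding alt1_def linear_span_image[OF lin] by blast
  qed
  moreover have "sl2_to_alt1 p \<in> alt1" for p
    by (auto simp: sl2_to_alt1_def subspace_add subspace_diff subspace_scale subspace_alt1 basis_vec_mem_alt1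
        split: prod.split)
  \<comment> \<open>The coordinates do not read the lower right entry; the vanishing trace recovers
    it.\<close>
  moreover have "?f (sl2_to_alt1 p) = p" if "p \<in> sl2 \<times> sl2" for p
    using that
    by (auto simp: sl2_to_alt1_def linear_add[OF lin] linear_scale[OF lin] sl2_def trace_2 sl2_vec_def
        vec_eq_iff forall_2 linear_diff[OF lin])
  moreover have "sl2_to_alt1 (?f x) = x" if "x \<in> alt1" for x
  proof -
    have "(sl2_to_alt1 \<circ> ?f) x = id x"
    proof (rule linear_eq_on[OF linear_compose[OF lin lin'] linear_id])
      show "x \<in> span alt1_basis"
        using that by (simp only: alt1_def)
      show "(sl2_to_alt1 \<circ> ?f) b = id b" if "b \<in> alt1_basis" for b
        using that by (auto simp: sl2_to_alt1_def sl2_vec_def)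
    qed
    then show ?thesis by simp
  qed
  ultimately have "bij_betw ?f alt1 (sl2 \<times> sl2)"
    by (intro bij_betw_byWitness[where f' = sl2_to_alt1]) blast+
  moreover have "?f (W_bracket x y) = dual_bracket commutator (?f x) (?f y)" if "x \<in> alt1" "y \<in> alt1" for x y
  proof (rule bilinear_eq[of "\<lambda>x y. ?f (W_bracket x y)" "\<lambda>x y. dual_bracket commutator (?f x) (?f y)"])
    show "bilinear (\<lambda>x y. ?f (W_bracket x y))"
      using bilinear_W_bracket by (simp add: bilinear_def linear_iff linear_add[OF lin] linear_scale[OF lin])
    have bil: "bilinear (dual_bracket commutator)"
      using bilinear_commutator
      by (auto simp: bilinear_def linear_iff dual_bracket_def algebra_simps)
    show "bilinear (\<lambda>x y. dual_bracket commutator (?f x) (?f y))"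
      by (simp add: bilinear_def[of "\<lambda>x y. dual_bracket commutator (?f x) (?f y)"] linear_iff
          linear_add[OF lin] linear_scale[OF lin] bilinear_ladd[OF bil] bilinear_radd[OF bil]
          bilinear_lmul[OF bil] bilinear_rmul[OF bil])
    show "?f (W_bracket a b) = dual_bracket commutator (?f a) (?f b)"
      if "a \<in> alt1_basis" "b \<in> alt1_basis" for a b
    proof -
      note comm = bilinear_lzero[OF bilinear_commutator] bilinear_rzero[OF bilinear_commutator]
      \<comment> \<open>Keeping the indices symbolic leaves four cases, in which
        \<open>sl2_vec_commutator\<close> handles all index pairs at once.\<close>
      have "\<exists>n\<in>{-1,0,1}. a = basis_vec (W_L n) \<or> a = basis_vec (W_Leps n)"
        "\<exists>n\<in>{-1,0,1}. b = basis_vec (W_L n) \<or> b = basis_vec (W_Leps n)"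
        using that by auto
      then show ?thesis
        by (elim bexE disjE; hypsubst)
           (simp_all del: insert_iff add: linear_scale[OF lin] linear_neg[OF lin] dual_bracket_def comm sl2_vec_commutator
             zero_prod_def linear_0[OF lin] add.commute flip: scaleR_minus_left)
    qed
  qed (use that in \<open>auto simp: alt1_def\<close>)
  ultimately show ?thesis
    unfolding lie_isomorphic_def
    using lin lie_algebra_subalgebra[OF lie_subalgebra_alt1] lie_algebra_dual[OF lie_algebra_sl2] by blast
qed

section \<open>The contraction\<close>

text \<open>\<open>stay\<close>, \<open>move\<close> and \<open>expel\<close> are the weights with
  which the vector at index \<open>n\<close> keeps its place, moves down to \<open>n - 1\<close>, or
  turns into the central element. Truncating \<open>1 / a - n\<close> keeps them continuous in
  \<open>a > 0\<close>, although the floor of \<open>1 / a\<close> jumps.\<close>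

definition stay :: "real \<Rightarrow> int \<Rightarrow> real" where
  "stay a n = sin (pi / 2 * max 0 (min 1 (1 / a - of_int n)))"

definition move :: "real \<Rightarrow> int \<Rightarrow> real" where
  "move a n = - sin (pi / 2 * max (-1) (min 0 (1 / a - of_int n)))"

text \<open>The sign depends on \<open>n\<close> alone and so does not disturb continuity in
  \<open>a\<close>. Neighbouring signs are opposite, which makes the rows of the rotated plane
  orthogonal.\<close>

definition expel :: "real \<Rightarrow> int \<Rightarrow> real" where
  "expel a n = (if even n then 1 else -1) * cos (pi / 2 * max (-1) (min 1 (1 / a - of_int n)))"

text \<open>Here \<open>S\<close> and \<open>C\<close> are sine and cosine of \<open>pi / 2\<close>
  times the fractional part of \<open>1 / a\<close>. With N the floor of \<open>1 / a\<close>, only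
  the rows N and N + 1 are nontrivial; on the plane of the vector at N and the central element they
  form an orthogonal 2 by 2 matrix. The sign \<open>\<sigma>\<close> is the parity of N.\<close>

lemma rotation_coeffs:
  obtains S C \<sigma> :: real where "S * S + C * C = 1" "\<sigma> * \<sigma> = 1"
    and "\<And>n. n < \<lfloor>1 / a\<rfloor> \<Longrightarrow> stay a n = 1 \<and> move a n = 0 \<and> expel a n = 0"
    and "stay a \<lfloor>1 / a\<rfloor> = S" "move a \<lfloor>1 / a\<rfloor> = 0" "expel a \<lfloor>1 / a\<rfloor> = \<sigma> * C"
    and "stay a (\<lfloor>1 / a\<rfloor> + 1) = 0" "move a (\<lfloor>1 / a\<rfloor> + 1) = C" "expel a (\<lfloor>1 / a\<rfloor> + 1) = - \<sigma> * S"
    and "\<And>n. n > \<lfloor>1 / a\<rfloor> + 1 \<Longrightarrow> stay a n = 0 \<and> move a n = 1 \<and> expel a n = 0"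
proof -
  define N where "N = \<lfloor>1 / a\<rfloor>"
  define s where "s = 1 / a - of_int N"
  have s: "0 \<le> s" "s < 1"
    unfolding s_def N_def by linarith+
  have a: "1 / a = s + of_int N"
    by (simp add: s_def)
  have before: "stay a n = 1 \<and> move a n = 0 \<and> expel a n = 0" if "n < N" for n
  proof -
    have "s + of_int N - of_int n \<ge> 1" using that s by linarith
    then show ?thesis by (simp add: stay_def move_def expel_def a)
  qed
  have after: "stay a n = 0 \<and> move a n = 1 \<and> expel a n = 0" if "n > N + 1" for n
  proof -
    have "s + of_int N - of_int n \<le> -1" using that s by linarith
    then show ?thesis by (simp add: stay_def move_def expel_def a)
  qed
  \<comment> \<open>Row N + 1 sees the argument \<open>s - 1\<close>, a quarter turn behind row N,
    so sine and cosine are exchanged.\<close>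
  have shift: "pi * (s - 1) / 2 = pi * s / 2 - pi / 2"
    by (simp add: right_diff_distrib diff_divide_distrib)
  have sc: "sin (pi * (s - 1) / 2) = - cos (pi * s / 2)" "cos (pi * (s - 1) / 2) = sin (pi * s / 2)"
    unfolding shift by (simp_all add: sin_diff cos_diff)
  show thesis
  proof (rule that[of "sin (pi / 2 * s)" "cos (pi / 2 * s)" "if even N then 1 else -1"])
    show "stay a \<lfloor>1 / a\<rfloor> = sin (pi / 2 * s)" "move a \<lfloor>1 / a\<rfloor> = 0"
      "expel a \<lfloor>1 / a\<rfloor> = (if even N then 1 else -1) * cos (pi / 2 * s)"
      using s unfolding N_def[symmetric] by (simp_all add: stay_def move_def expel_def a)
    have "s + of_int N - of_int (N + 1) = s - 1" by simp
    then show "stay a (\<lfloor>1 / a\<rfloor> + 1) = 0" "move a (\<lfloor>1 / a\<rfloor> + 1) = cos (pi / 2 * s)"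
      "expel a (\<lfloor>1 / a\<rfloor> + 1) = - (if even N then 1 else -1) * sin (pi / 2 * s)"
      using s unfolding N_def[symmetric] unfolding stay_def move_def expel_def a by (simp_all add: sc)
    show "sin (pi / 2 * s) * sin (pi / 2 * s) + cos (pi / 2 * s) * cos (pi / 2 * s) = 1"
      using sin_cos_squared_add[of "pi / 2 * s"] by (simp only: power2_eq_square)
  qed (use before after in \<open>simp_all flip: N_def\<close>)
qed

definition rotate_out :: "real \<Rightarrow> (int \<Rightarrow> 'v) \<Rightarrow> 'v \<Rightarrow> int \<Rightarrow> 'v::real_vector" where
  "rotate_out a e k n = stay a n *\<^sub>R e n + move a n *\<^sub>R e (n - 1) + expel a n *\<^sub>R k"

text \<open>\<open>rotate_in\<close> and \<open>expelled\<close> are the columns of the coefficient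
  matrix of \<open>rotate_out\<close>: they apply its transpose, which is the inverse of an
  orthogonal matrix. The column of the central element is supported on two rows only.\<close>

definition rotate_in :: "real \<Rightarrow> (int \<Rightarrow> 'v) \<Rightarrow> int \<Rightarrow> 'v::real_vector" where
  "rotate_in a w j = stay a j *\<^sub>R w j + move a (j + 1) *\<^sub>R w (j + 1)"

definition expelled :: "real \<Rightarrow> (int \<Rightarrow> 'v) \<Rightarrow> 'v::real_vector" where
  "expelled a w = expel a \<lfloor>1 / a\<rfloor> *\<^sub>R w \<lfloor>1 / a\<rfloor> + expel a (\<lfloor>1 / a\<rfloor> + 1) *\<^sub>R w (\<lfloor>1 / a\<rfloor> + 1)"

text \<open>With M the coefficient matrix, the first equation says that M times its transpose is the
  identity; the other two say it for the transpose times M.\<close>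

lemma
  fixes w :: "int \<Rightarrow> 'v::real_vector"
  shows rotate_out_rotate_in: "rotate_out a (rotate_in a w) (expelled a w) n = w n" (is ?out)
    and rotate_in_rotate_out: "rotate_in a (rotate_out a e k) n = (e n :: 'v)" (is ?in)
    and expelled_rotate_out: "expelled a (rotate_out a e k) = k" (is ?expelled)
proof -
  define N where "N = \<lfloor>1 / a\<rfloor>"
  obtain S C \<sigma> where 1: "S * S + C * C = 1" "\<sigma> * \<sigma> = 1"
    and before: "\<And>n. n < N \<Longrightarrow> stay a n = 1 \<and> move a n = 0 \<and> expel a n = 0"
    and N: "stay a N = S" "move a N = 0" "expel a N = \<sigma> * C"
      "stay a (N + 1) = 0" "move a (N + 1) = C" "expel a (N + 1) = - \<sigma> * S"
    and after: "\<And>n. n > N + 1 \<Longrightarrow> stay a n = 0 \<and> move a n = 1 \<and> expel a n = 0"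
    by (rule rotation_coeffs[of a, folded N_def]) (rule that)
  have stay0: "stay a n = 0" if "n > N" for n
    using N after[of n] that by (cases "n = N + 1") auto
  \<comment> \<open>The first two identities are the rows of the block times its transpose, the last
    two those of the transpose times the block.\<close>
  have row: "S *\<^sub>R (S *\<^sub>R u + C *\<^sub>R v) + (\<sigma> * C) *\<^sub>R ((\<sigma> * C) *\<^sub>R u + (- \<sigma> * S) *\<^sub>R v) = u"
    "C *\<^sub>R (S *\<^sub>R u + C *\<^sub>R v) + (- \<sigma> * S) *\<^sub>R ((\<sigma> * C) *\<^sub>R u + (- \<sigma> * S) *\<^sub>R v) = v"
    "S *\<^sub>R (S *\<^sub>R u + (\<sigma> * C) *\<^sub>R v) + C *\<^sub>R (C *\<^sub>R u + (- \<sigma> * S) *\<^sub>R v) = u"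
    "(\<sigma> * C) *\<^sub>R (S *\<^sub>R u + (\<sigma> * C) *\<^sub>R v) + (- \<sigma> * S) *\<^sub>R (C *\<^sub>R u + (- \<sigma> * S) *\<^sub>R v) = v"
    for u v :: 'v
  proof -
    have comb: "p *\<^sub>R (q *\<^sub>R u + r *\<^sub>R v) + p' *\<^sub>R (q' *\<^sub>R u + r' *\<^sub>R v) =
        (p * q + p' * q') *\<^sub>R u + (p * r + p' * r') *\<^sub>R v" for p q r p' q' r'
      by (simp add: scaleR_add_right scaleR_add_left)
    have sq: "S * S + \<sigma> * C * (\<sigma> * C) = S * S + (\<sigma> * \<sigma>) * (C * C)"
      "C * C + - \<sigma> * S * (- \<sigma> * S) = C * C + (\<sigma> * \<sigma>) * (S * S)"
      "S * C + \<sigma> * C * (- \<sigma> * S) = S * C - (\<sigma> * \<sigma>) * (C * S)"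
      "C * S + - \<sigma> * S * (\<sigma> * C) = C * S - (\<sigma> * \<sigma>) * (C * S)"
      "\<sigma> * C * (\<sigma> * C) + - \<sigma> * S * (- \<sigma> * S) = (\<sigma> * \<sigma>) * (S * S + C * C)"
      by (simp_all add: algebra_simps)
    have "C * C + S * S = 1" using 1 by simp
    then show "S *\<^sub>R (S *\<^sub>R u + C *\<^sub>R v) + (\<sigma> * C) *\<^sub>R ((\<sigma> * C) *\<^sub>R u + (- \<sigma> * S) *\<^sub>R v) = u"
      "C *\<^sub>R (S *\<^sub>R u + C *\<^sub>R v) + (- \<sigma> * S) *\<^sub>R ((\<sigma> * C) *\<^sub>R u + (- \<sigma> * S) *\<^sub>R v) = v"
      "S *\<^sub>R (S *\<^sub>R u + (\<sigma> * C) *\<^sub>R v) + C *\<^sub>R (C *\<^sub>R u + (- \<sigma> * S) *\<^sub>R v) = u"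
      "(\<sigma> * C) *\<^sub>R (S *\<^sub>R u + (\<sigma> * C) *\<^sub>R v) + (- \<sigma> * S) *\<^sub>R (C *\<^sub>R u + (- \<sigma> * S) *\<^sub>R v) = v"
      unfolding comb sq 1 by (simp_all add: 1 algebra_simps)
  qed
  \<comment> \<open>The index \<open>N - 1\<close> is listed separately because
    \<open>rotate_in\<close> also involves its right neighbour N, which belongs to the
    block.\<close>
  consider "n < N - 1" | "n = N - 1" | "n = N" | "n = N + 1" | "n > N + 1"
    by linarith
  note cases = this
  show ?out
    using row[of "w N" "w (N + 1)"]
    by (cases rule: cases)
       (simp_all add: rotate_out_def rotate_in_def expelled_def before after N stay0 flip: N_def)
  show ?in
    using row[of "e N" k]
    by (cases rule: cases)
       (simp_all add: rotate_out_def rotate_in_def before after N stay0 add.commute[of 1 N] flip: N_def)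
  show ?expelled
    using row[of "e N" k]
    by (simp add: rotate_out_def expelled_def N flip: N_def)
qed

text \<open>Once \<open>1 / a\<close> is at least \<open>n + 1\<close>, the index \<open>n\<close>
  lies below the floor of \<open>1 / a\<close> and is untouched by the shift.\<close>

lemma eventually_settled:
  "eventually (\<lambda>a. a > 0 \<and> stay a n = 1 \<and> move a n = 0 \<and> expel a n = 0) (at_right 0)"
proof -
  have "eventually (\<lambda>a. inverse a \<ge> of_int (n + 1)) (at_right (0::real))"
    using filterlim_inverse_at_top_right by (simp add: filterlim_at_top)
  moreover have "eventually (\<lambda>a. a > 0) (at_right (0::real))"
    by (simp add: eventually_at_right_less)
  ultimately show ?thesis
  proof eventually_elim
    case (elim a)
    have "1 / a - of_int n \<ge> 1"
      using elim by (simp add: inverse_eq_divide)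
    then show ?case
      using elim by (simp add: stay_def move_def expel_def)
  qed
qed

lemma tendsto_rotate_in: "((\<lambda>a. rotate_in a w j) \<longlongrightarrow> (w j :: 'v::real_normed_vector)) (at_right 0)"
proof (rule tendsto_eventually)
  show "eventually (\<lambda>a. rotate_in a w j = w j) (at_right 0)"
    using eventually_settled[of j] eventually_settled[of "j + 1"]
    by eventually_elim (simp add: rotate_in_def)
qed

lemma tendsto_expelled:
  fixes w :: "int \<Rightarrow> 'v::real_normed_vector"
  assumes "\<And>n. norm (w n) \<le> 1"
  shows "((\<lambda>a. a *\<^sub>R expelled a w) \<longlongrightarrow> 0) (at_right 0)"
proof (rule Lim_null_comparison)
  have *: "\<bar>expel a n\<bar> \<le> 1" for a n
    by (simp add: expel_def abs_mult)
  have **: "norm (expel a n *\<^sub>R w n) \<le> 1" for a n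
    using mult_mono[OF *[of a n] assms[of n]] by simp
  have "norm (expelled a w) \<le> 2" for a
    unfolding expelled_def
    by (rule order_trans[OF norm_triangle_mono[OF ** **]]) simp
  then show "eventually (\<lambda>a. norm (a *\<^sub>R expelled a w) \<le> \<bar>a\<bar> * 2) (at_right 0)"
    by (auto intro!: always_eventually mult_left_mono)
  show "((\<lambda>a::real. \<bar>a\<bar> * 2) \<longlongrightarrow> 0) (at_right 0)"
    by (auto intro!: tendsto_eq_intros)
qed

lemma norm_basis_vec [simp]: "norm (basis_vec b) = 1"
  by (simp add: norm_poly_mapping_def dist_poly_mapping_def)

section \<open>The change of basis and its inverse\<close>

type_synonym vir_pair = "(vir_basis \<Rightarrow>\<^sub>0 real) \<times> (vir_basis \<Rightarrow>\<^sub>0 real)"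

abbreviation vir_sum :: "int \<Rightarrow> vir_pair" where
  "vir_sum n \<equiv> (basis_vec (Vir_L n), basis_vec (Vir_L n))"

abbreviation vir_diff :: "int \<Rightarrow> vir_pair" where
  "vir_diff n \<equiv> (basis_vec (Vir_L n), - basis_vec (Vir_L n))"

fun contr_basis :: "real \<Rightarrow> W_basis \<Rightarrow> vir_pair" where
  "contr_basis a (W_L n) = rotate_out a vir_sum ((1 / a) *\<^sub>R (basis_vec Vir_K, 0)) n"
| "contr_basis a (W_Leps n) = rotate_out a (\<lambda>n. a *\<^sub>R vir_diff n) ((1 / a) *\<^sub>R (0, basis_vec Vir_K)) n"

abbreviation L_vec :: "int \<Rightarrow> W_basis \<Rightarrow>\<^sub>0 real" where "L_vec n \<equiv> basis_vec (W_L n)"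
abbreviation Leps_vec :: "int \<Rightarrow> W_basis \<Rightarrow>\<^sub>0 real" where "Leps_vec n \<equiv> basis_vec (W_Leps n)"

text \<open>A generator of the first summand is half of \<open>vir_sum\<close> plus half of
  \<open>vir_diff\<close>; since the basis contains \<open>a\<close> times \<open>vir_diff\<close>,
  the second half carries \<open>1 / (2 * a)\<close>. In \<open>contr_inv_right\<close> only the
  sign of that half changes.\<close>

fun contr_inv_left :: "real \<Rightarrow> vir_basis \<Rightarrow> W_basis \<Rightarrow>\<^sub>0 real" where
  "contr_inv_left a (Vir_L j) = (1 / 2) *\<^sub>R rotate_in a L_vec j + (1 / (2 * a)) *\<^sub>R rotate_in a Leps_vec j"
| "contr_inv_left a Vir_K = a *\<^sub>R expelled a L_vec"

fun contr_inv_right :: "real \<Rightarrow> vir_basis \<Rightarrow> W_basis \<Rightarrow>\<^sub>0 real" where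
  "contr_inv_right a (Vir_L j) = (1 / 2) *\<^sub>R rotate_in a L_vec j - (1 / (2 * a)) *\<^sub>R rotate_in a Leps_vec j"
| "contr_inv_right a Vir_K = a *\<^sub>R expelled a Leps_vec"

definition contr :: "real \<Rightarrow> (W_basis \<Rightarrow>\<^sub>0 real) \<Rightarrow> vir_pair" where
  "contr a = lin_ext (contr_basis a)"

definition contr_inv :: "real \<Rightarrow> vir_pair \<Rightarrow> W_basis \<Rightarrow>\<^sub>0 real" where
  "contr_inv a p = lin_ext (contr_inv_left a) (fst p) + lin_ext (contr_inv_right a) (snd p)"

lemma linear_contr: "linear (contr a)"
  unfolding contr_def by (rule linear_lin_ext)

lemma contr_basis_vec [simp]: "contr a (basis_vec b) = contr_basis a b"
  by (simp add: contr_def)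

lemma linear_contr_inv: "linear (contr_inv a)"
  by (simp add: contr_inv_def linear_iff linear_add[OF linear_lin_ext] linear_scale[OF linear_lin_ext]
      scaleR_add_right)

lemma linear_rotate_out: "linear f \<Longrightarrow> f (rotate_out a e k n) = rotate_out a (\<lambda>n. f (e n)) (f k) n"
  by (simp add: rotate_out_def linear_add linear_scale)

lemma linear_rotate_in: "linear f \<Longrightarrow> f (rotate_in a w n) = rotate_in a (\<lambda>n. f (w n)) n"
  by (simp add: rotate_in_def linear_add linear_scale)

lemma linear_expelled: "linear f \<Longrightarrow> f (expelled a w) = expelled a (\<lambda>n. f (w n))"
  by (simp add: expelled_def linear_add linear_scale)

lemma contr_inv_simps:
  assumes "a > 0"
  shows "contr_inv a (vir_sum n) = rotate_in a L_vec n"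
    and "contr_inv a (a *\<^sub>R vir_diff n) = rotate_in a Leps_vec n"
    and "contr_inv a ((1 / a) *\<^sub>R (basis_vec Vir_K, 0)) = expelled a L_vec"
    and "contr_inv a ((1 / a) *\<^sub>R (0, basis_vec Vir_K)) = expelled a Leps_vec"
    and "contr_inv a (basis_vec Vir_K, 0) = a *\<^sub>R expelled a L_vec"
    and "contr_inv a (0, basis_vec Vir_K) = a *\<^sub>R expelled a Leps_vec"
proof -
  note [simp] = linear_neg[OF linear_lin_ext] linear_0[OF linear_lin_ext] linear_scale[OF linear_lin_ext]
  have half: "(1 / 2) *\<^sub>R v + (1 / 2) *\<^sub>R v = v" for v :: "W_basis \<Rightarrow>\<^sub>0 real"
    by (simp flip: scaleR_add_left)
  show "contr_inv a (vir_sum n) = rotate_in a L_vec n"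
    using half by (simp add: contr_inv_def)
  show "contr_inv a (a *\<^sub>R vir_diff n) = rotate_in a Leps_vec n"
    using assms half by (simp add: contr_inv_def scaleR_add_right scaleR_diff_right)
  show "contr_inv a ((1 / a) *\<^sub>R (basis_vec Vir_K, 0)) = expelled a L_vec"
    "contr_inv a ((1 / a) *\<^sub>R (0, basis_vec Vir_K)) = expelled a Leps_vec"
    "contr_inv a (basis_vec Vir_K, 0) = a *\<^sub>R expelled a L_vec"
    "contr_inv a (0, basis_vec Vir_K) = a *\<^sub>R expelled a Leps_vec"
    using assms by (simp_all add: contr_inv_def)
qed

text \<open>Linear maps pass through \<open>rotate_out\<close>, so on the basis this reduces to
  \<open>rotate_out_rotate_in\<close>.\<close>

lemma contr_inv_contr:
  assumes "a > 0"
  shows "contr_inv a (contr a x) = x"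
proof -
  have "(contr_inv a \<circ> contr a) x = id x"
  proof (rule linear_eq_on_basis[OF linear_compose[OF linear_contr linear_contr_inv] linear_id])
    show "(contr_inv a \<circ> contr a) (basis_vec b) = id (basis_vec b)" for b
      using assms
      by (cases b)
         (simp_all add: linear_rotate_out[OF linear_contr_inv] contr_inv_simps
            rotate_out_rotate_in del: scaleR_Pair)
  qed
  then show ?thesis by simp
qed

lemma contr_rotate_in:
  "contr a (rotate_in a L_vec n) = vir_sum n"
  "contr a (rotate_in a Leps_vec n) = a *\<^sub>R vir_diff n"
  by (simp_all add: linear_rotate_in[OF linear_contr] rotate_in_rotate_out del: scaleR_Pair)

lemma contr_expelled:
  "contr a (expelled a L_vec) = (1 / a) *\<^sub>R (basis_vec Vir_K, 0)"
  "contr a (expelled a Leps_vec) = (1 / a) *\<^sub>R (0, basis_vec Vir_K)"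
  by (simp_all add: linear_expelled[OF linear_contr] expelled_rotate_out del: scaleR_Pair)

lemma contr_contr_inv:
  assumes "a > 0"
  shows "contr a (contr_inv a p) = p"
proof -
  note lin = linear_add[OF linear_contr] linear_diff[OF linear_contr] linear_scale[OF linear_contr]
  have half: "(1 / 2) *\<^sub>R v + (1 / 2) *\<^sub>R v = v" for v :: "vir_basis \<Rightarrow>\<^sub>0 real"
    by (simp flip: scaleR_add_left)
  have left: "(contr a \<circ> lin_ext (contr_inv_left a)) u = (u, 0)" for u
  proof (rule linear_eq_on_basis[OF linear_compose[OF linear_lin_ext linear_contr]])
    show "linear (\<lambda>u :: vir_basis \<Rightarrow>\<^sub>0 real. (u, 0 :: vir_basis \<Rightarrow>\<^sub>0 real))"
      by (simp add: linear_iff)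
    show "(contr a \<circ> lin_ext (contr_inv_left a)) (basis_vec b) = (basis_vec b, 0)" for b
      using assms by (cases b) (simp_all add: lin contr_rotate_in contr_expelled half)
  qed
  have right: "(contr a \<circ> lin_ext (contr_inv_right a)) u = (0, u)" for u
  proof (rule linear_eq_on_basis[OF linear_compose[OF linear_lin_ext linear_contr]])
    show "linear (\<lambda>u :: vir_basis \<Rightarrow>\<^sub>0 real. (0 :: vir_basis \<Rightarrow>\<^sub>0 real, u))"
      by (simp add: linear_iff)
    show "(contr a \<circ> lin_ext (contr_inv_right a)) (basis_vec b) = (0, basis_vec b)" for b
      using assms by (cases b) (simp_all add: lin contr_rotate_in contr_expelled half)
  qed
  show ?thesis
    using left[of "fst p"] right[of "snd p"] by (simp add: contr_inv_def lin)
qed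

lemma bij_contr: "a > 0 \<Longrightarrow> bij (contr a)"
  by (rule o_bij[of "contr_inv a"]) (auto simp: fun_eq_iff contr_inv_contr contr_contr_inv)

lemma inv_contr: "a > 0 \<Longrightarrow> inv (contr a) = contr_inv a"
  by (rule inv_unique_comp) (auto simp: fun_eq_iff contr_inv_contr contr_contr_inv)

text \<open>For fixed \<open>x\<close> the sum is finite over an index set independent of
  \<open>a\<close>, and the weights in \<open>rotate_out\<close> contain no floor.\<close>

lemma continuous_on_contr: "continuous_on {0<..} (\<lambda>a. contr a x)"
proof -
  have "continuous_on {0<..} (\<lambda>a. contr_basis a b)" for b
    by (cases b)
       (auto simp: rotate_out_def stay_def move_def expel_def simp del: scaleR_Pair intro!: continuous_intros)
  then show ?thesis
    unfolding contr_def lin_ext_def by (intro continuous_intros)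
qed

text \<open>The change of basis without the shift. It agrees with \<open>contr\<close> on a given
  basis vector for all small \<open>a\<close>, how small depending on the vector.\<close>

fun settled :: "real \<Rightarrow> W_basis \<Rightarrow> vir_pair" where
  "settled a (W_L n) = vir_sum n"
| "settled a (W_Leps n) = a *\<^sub>R vir_diff n"

lemma eventually_contr_basis_vec: "eventually (\<lambda>a. contr a (basis_vec b) = settled a b) (at_right 0)"
proof (cases b)
  case (W_L n)
  then show ?thesis
    using eventually_settled[of n] by (auto elim!: eventually_mono simp: contr_def rotate_out_def)
next
  case (W_Leps n)
  then show ?thesis
    using eventually_settled[of n] by (auto elim!: eventually_mono simp: contr_def rotate_out_def)
qed

section \<open>The limit of the structure constants\<close>

abbreviation vir2_bracket :: "real \<Rightarrow> real \<Rightarrow> vir_pair \<Rightarrow> vir_pair \<Rightarrow> vir_pair" where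
  "vir2_bracket c c' \<equiv> direct_sum_bracket (vir_bracket c) (vir_bracket c')"

lemma bilinear_vir2_bracket: "bilinear (vir2_bracket c c')"
proof -
  note simps = bilinear_ladd[OF bilinear_vir_bracket] bilinear_radd[OF bilinear_vir_bracket]
    bilinear_lmul[OF bilinear_vir_bracket] bilinear_rmul[OF bilinear_vir_bracket]
  show ?thesis
    by (auto simp: bilinear_def linear_iff direct_sum_bracket_def simps)
qed

text \<open>The Gelfand-Fuchs cocycle of the vector fields on the circle, up to
  normalisation.\<close>

definition cocycle :: "int \<Rightarrow> int \<Rightarrow> real" where
  "cocycle n m = (if n + m = 0 then of_int (n * (n\<^sup>2 - 1)) else 0)"

lemma vir2_bracket_settled:
  "vir2_bracket c c' (vir_sum n) (vir_sum m) =
     of_int (n - m) *\<^sub>R vir_sum (n + m)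
     + (c * cocycle n m) *\<^sub>R (basis_vec Vir_K, 0) + (c' * cocycle n m) *\<^sub>R (0, basis_vec Vir_K)"
  "vir2_bracket c c' (vir_sum n) (vir_diff m) =
     of_int (n - m) *\<^sub>R vir_diff (n + m)
     + (c * cocycle n m) *\<^sub>R (basis_vec Vir_K, 0) - (c' * cocycle n m) *\<^sub>R (0, basis_vec Vir_K)"
  "vir2_bracket c c' (vir_diff n) (vir_sum m) =
     of_int (n - m) *\<^sub>R vir_diff (n + m)
     + (c * cocycle n m) *\<^sub>R (basis_vec Vir_K, 0) - (c' * cocycle n m) *\<^sub>R (0, basis_vec Vir_K)"
  "vir2_bracket c c' (vir_diff n) (vir_diff m) =
     of_int (n - m) *\<^sub>R vir_sum (n + m)
     + (c * cocycle n m) *\<^sub>R (basis_vec Vir_K, 0) + (c' * cocycle n m) *\<^sub>R (0, basis_vec Vir_K)"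
  by (simp_all add: direct_sum_bracket_def bilinear_lneg[OF bilinear_vir_bracket]
      bilinear_rneg[OF bilinear_vir_bracket] cocycle_def)

text \<open>Pulled back by \<open>contr_inv\<close>, a central element becomes \<open>E\<close> or
  \<open>E'\<close>, which tend to 0. Among the other terms, sum with sum gives a sum, sum with
  difference gives a difference with matching powers of \<open>a\<close>, and difference with
  difference gives a sum with the factor \<open>a\<close> squared.\<close>

lemma tendsto_contr_inv_bracket:
  "((\<lambda>a. contr_inv a (vir2_bracket c c' (settled a b) (settled a b'))) \<longlongrightarrow> W_table b b') (at_right 0)"
proof -
  note lin = linear_add[OF linear_contr_inv] linear_diff[OF linear_contr_inv]
  note scale = linear_scale[OF linear_contr_inv]
  define R where "R a n = rotate_in a L_vec n" for a n
  define R' where "R' a n = rotate_in a Leps_vec n" for a n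
  define E where "E a = a *\<^sub>R expelled a L_vec" for a
  define E' where "E' a = a *\<^sub>R expelled a Leps_vec" for a
  note folds = R_def[symmetric] R'_def[symmetric] E_def[symmetric] E'_def[symmetric]
  have lims: "((\<lambda>a. R a n) \<longlongrightarrow> L_vec n) (at_right 0)" "((\<lambda>a. R' a n) \<longlongrightarrow> Leps_vec n) (at_right 0)"
    "(E \<longlongrightarrow> 0) (at_right 0)" "(E' \<longlongrightarrow> 0) (at_right 0)" for n
    unfolding R_def R'_def E_def E'_def by (intro tendsto_rotate_in tendsto_expelled; simp)+
  have lim_a: "((\<lambda>a::real. a) \<longlongrightarrow> 0) (at_right 0)"
    by (rule tendsto_ident_at)
  note br_scale = bilinear_lmul[OF bilinear_vir2_bracket] bilinear_rmul[OF bilinear_vir2_bracket]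
  have diff: "contr_inv a (vir_diff n) = (1 / a) *\<^sub>R R' a n" if "a > 0" for a n
    using contr_inv_simps(2)[OF that, of n] that unfolding R'_def scale by (metis scaleR_one scaleR_scaleR nonzero_divide_eq_eq less_numeral_extra(3))
  have *: "(f \<longlongrightarrow> l) (at_right 0)"
    if "(g \<longlongrightarrow> l') (at_right 0)" "l = l'" "\<And>a. a > 0 \<Longrightarrow> f a = g a"
    for f g :: "real \<Rightarrow> W_basis \<Rightarrow>\<^sub>0 real" and l l'
    using that(1) unfolding that(2)
    by (rule Lim_transform_eventually) (auto simp: that(3) intro!: eventually_at_right_less[THEN eventually_mono])
  show ?thesis
  proof (cases b; cases b')
    fix n m assume b: "b = W_L n" "b' = W_L m"
    show ?thesis
    proof (rule *)
      show "((\<lambda>a. of_int (n - m) *\<^sub>R R a (n + m) + (c * cocycle n m) *\<^sub>R E a + (c' * cocycle n m) *\<^sub>R E' a)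
         \<longlongrightarrow> of_int (n - m) *\<^sub>R L_vec (n + m) + (c * cocycle n m) *\<^sub>R 0 + (c' * cocycle n m) *\<^sub>R 0) (at_right 0)"
        by (intro tendsto_intros lims)
    qed (simp_all only: b settled.simps vir2_bracket_settled lin scale contr_inv_simps folds, simp)
  next
    fix n m assume b: "b = W_L n" "b' = W_Leps m"
    show ?thesis
    proof (rule *)
      show "((\<lambda>a. of_int (n - m) *\<^sub>R R' a (n + m) + a *\<^sub>R ((c * cocycle n m) *\<^sub>R E a - (c' * cocycle n m) *\<^sub>R E' a))
         \<longlongrightarrow> of_int (n - m) *\<^sub>R Leps_vec (n + m) + 0 *\<^sub>R ((c * cocycle n m) *\<^sub>R 0 - (c' * cocycle n m) *\<^sub>R 0)) (at_right 0)"
        by (intro tendsto_intros lims lim_a)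
      \<comment> \<open>The \<open>1 / a\<close> from \<open>diff\<close> cancels the
        \<open>a\<close> of the eps generator on the main term, while the central terms keep that
        \<open>a\<close>.\<close>
      show "contr_inv a (vir2_bracket c c' (settled a b) (settled a b')) =
        of_int (n - m) *\<^sub>R R' a (n + m) + a *\<^sub>R ((c * cocycle n m) *\<^sub>R E a - (c' * cocycle n m) *\<^sub>R E' a)" if "a > 0" for a
        using that
        by (simp only: b settled.simps br_scale vir2_bracket_settled lin scale contr_inv_simps diff folds)
           (simp add: algebra_simps)
    qed (simp add: b)
  next
    fix n m assume b: "b = W_Leps n" "b' = W_L m"
    show ?thesis
    proof (rule *)
      show "((\<lambda>a. of_int (n - m) *\<^sub>R R' a (n + m) + a *\<^sub>R ((c * cocycle n m) *\<^sub>R E a - (c' * cocycle n m) *\<^sub>R E' a))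
         \<longlongrightarrow> of_int (n - m) *\<^sub>R Leps_vec (n + m) + 0 *\<^sub>R ((c * cocycle n m) *\<^sub>R 0 - (c' * cocycle n m) *\<^sub>R 0)) (at_right 0)"
        by (intro tendsto_intros lims lim_a)
      show "contr_inv a (vir2_bracket c c' (settled a b) (settled a b')) =
        of_int (n - m) *\<^sub>R R' a (n + m) + a *\<^sub>R ((c * cocycle n m) *\<^sub>R E a - (c' * cocycle n m) *\<^sub>R E' a)" if "a > 0" for a
        using that
        by (simp only: b settled.simps br_scale vir2_bracket_settled lin scale contr_inv_simps diff folds)
           (simp add: algebra_simps)
    qed (simp add: b add.commute flip: scaleR_minus_left)
  next
    fix n m assume b: "b = W_Leps n" "b' = W_Leps m"
    show ?thesis
    proof (rule *)
      \<comment> \<open>The bracket of two eps generators falls into the family of the L_n with a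
        factor \<open>a\<close> twice, which makes the eps part abelian in the limit.\<close>
      show "((\<lambda>a. a *\<^sub>R a *\<^sub>R (of_int (n - m) *\<^sub>R R a (n + m) + (c * cocycle n m) *\<^sub>R E a + (c' * cocycle n m) *\<^sub>R E' a))
         \<longlongrightarrow> 0 *\<^sub>R 0 *\<^sub>R (of_int (n - m) *\<^sub>R L_vec (n + m) + (c * cocycle n m) *\<^sub>R 0 + (c' * cocycle n m) *\<^sub>R 0)) (at_right 0)"
        by (intro tendsto_intros lims lim_a)
    qed (simp_all only: b settled.simps br_scale vir2_bracket_settled lin scale contr_inv_simps folds, simp)
  qed
qed

text \<open>Expands a bilinear map into a finite sum whose index set does not depend on the map, so
  that limits can be taken term by term.\<close>

lemma bilinear_conv_sum:
  assumes "bilinear h"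
  shows "h x y = lin_ext (\<lambda>b. lin_ext (\<lambda>b'. h (basis_vec b) (basis_vec b')) y) x"
proof -
  have l: "linear (h u)" "linear (\<lambda>u. h u v)" for u v
    using assms unfolding bilinear_def by blast+
  show ?thesis
    by (subst linear_eq_lin_ext[OF l(2)], subst linear_eq_lin_ext[OF l(1)]) (rule refl)
qed

lemma tendsto_lin_ext:
  fixes f :: "'p \<Rightarrow> 'b \<Rightarrow> 'v::real_normed_vector"
  assumes "\<And>b. ((\<lambda>a. f a b) \<longlongrightarrow> l b) F"
  shows "((\<lambda>a. lin_ext (f a) x) \<longlongrightarrow> lin_ext l x) F"
  unfolding lin_ext_def by (intro tendsto_intros assms)

lemma is_contraction_vir_W: "is_contraction (vir2_bracket c c') W_bracket"
  unfolding is_contraction_def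
proof (intro conjI exI allI impI)
  show "lie_algebra UNIV (vir2_bracket c c')"
    by (intro lie_algebra_direct_sum lie_algebra_vir_bracket)
  show "lie_algebra UNIV W_bracket"
    by (rule lie_algebra_W_bracket)
  show "linear (contr a)" for a
    by (rule linear_contr)
  show "bij (contr a)" if "0 < a" for a
    using that by (rule bij_contr)
  show "continuous_on {0<..} (\<lambda>a. contr a x)" for x
    by (rule continuous_on_contr)
  show "((\<lambda>a. inv (contr a) (vir2_bracket c c' (contr a x) (contr a y))) \<longlongrightarrow> W_bracket x y) (at_right 0)" for x y
  proof -
    \<comment> \<open>With \<open>contr_inv\<close> in place of \<open>inv (contr a)\<close>,
      bilinearity holds for every \<open>a\<close>; the two agree for \<open>a > 0\<close>, which is
      all the limit sees.\<close>
    define h where "h a x y = contr_inv a (vir2_bracket c c' (contr a x) (contr a y))" for a x y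
    have "bilinear (h a)" for a
      unfolding bilinear_def h_def
      by (auto intro!: linearI simp: linear_add[OF linear_contr] linear_scale[OF linear_contr]
          linear_add[OF linear_contr_inv] linear_scale[OF linear_contr_inv]
          bilinear_ladd[OF bilinear_vir2_bracket] bilinear_radd[OF bilinear_vir2_bracket]
          bilinear_lmul[OF bilinear_vir2_bracket] bilinear_rmul[OF bilinear_vir2_bracket])
    note h = bilinear_conv_sum[OF this]
    have "((\<lambda>a. h a (basis_vec b) (basis_vec b')) \<longlongrightarrow> W_table b b') (at_right 0)" for b b'
    proof (rule Lim_transform_eventually[OF tendsto_contr_inv_bracket])
      show "eventually (\<lambda>a. contr_inv a (vir2_bracket c c' (settled a b) (settled a b')) =
          h a (basis_vec b) (basis_vec b')) (at_right 0)"
        using eventually_contr_basis_vec[of b] eventually_contr_basis_vec[of b']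
        by eventually_elim (simp add: h_def)
    qed
    then have "((\<lambda>a. h a x y) \<longlongrightarrow> W_bracket x y) (at_right 0)"
      unfolding W_bracket_def bilin_ext_def by (subst h) (intro tendsto_lin_ext)
    then show ?thesis
      by (rule Lim_transform_eventually)
         (auto simp: h_def inv_contr intro!: eventually_at_right_less[THEN eventually_mono])
  qed
  show "((\<lambda>a. contr a x) \<longlongrightarrow> lin_ext (settled 0) x) (at_right 0)" for x
    unfolding contr_def
  proof (rule tendsto_lin_ext)
    have "((\<lambda>a. settled a b) \<longlongrightarrow> settled 0 b) (at_right 0)" for b
      by (cases b) (auto intro!: tendsto_eq_intros simp del: scaleR_Pair)
    then show "((\<lambda>a. contr_basis a b) \<longlongrightarrow> settled 0 b) (at_right 0)" for b
      by (rule Lim_transform_eventually)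
         (use eventually_contr_basis_vec[of b] in \<open>auto simp: contr_def elim!: eventually_mono\<close>)
  qed
  \<comment> \<open>The limiting map annihilates the eps generators; one nonzero vector in its
    kernel shows that the change of basis becomes singular.\<close>
  have "lin_ext (settled 0) (Leps_vec 0) = lin_ext (settled 0) 0"
    by (simp add: linear_0[OF linear_lin_ext] zero_prod_def)
  moreover have "Leps_vec 0 \<noteq> 0"
    using norm_basis_vec[of "W_Leps 0"] by force
  ultimately show "\<not> inj (lin_ext (settled 0))"
    by (metis injD)
qed

section \<open>The representation by differential operators\<close>

lemma d_t_real_derivative:
  assumes "f differentiable (at (t, r))"
  shows "((\<lambda>s. f (s, r)) has_real_derivative d_t f (t, r)) (at t)"
proof -
  have "(f \<circ> (\<lambda>s. (s, r))) differentiable (at t)"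
    using assms by (intro differentiable_chain_at) (auto intro!: derivative_intros)
  then show ?thesis
    by (simp add: d_t_def o_def flip: DERIV_deriv_iff_real_differentiable)
qed

lemma d_r_real_derivative:
  assumes "f differentiable (at (t, r))"
  shows "((\<lambda>s. f (t, s)) has_real_derivative d_r f (t, r)) (at r)"
proof -
  have "(f \<circ> (\<lambda>s. (t, s))) differentiable (at r)"
    using assms by (intro differentiable_chain_at) (auto intro!: derivative_intros)
  then show ?thesis
    by (simp add: d_r_def o_def flip: DERIV_deriv_iff_real_differentiable)
qed

lemma d_tI: "((\<lambda>s. f (s, r)) has_real_derivative l) (at t) \<Longrightarrow> d_t f (t, r) = l"
  by (simp add: d_t_def DERIV_imp_deriv)

lemma d_rI: "((\<lambda>s. f (t, s)) has_real_derivative l) (at r) \<Longrightarrow> d_r f (t, r) = l"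
  by (simp add: d_r_def DERIV_imp_deriv)

lemma
  assumes "f differentiable (at p)" "g differentiable (at p)"
  shows d_t_add: "d_t (\<lambda>q. f q + g q) p = d_t f p + d_t g p"
    and d_r_add: "d_r (\<lambda>q. f q + g q) p = d_r f p + d_r g p"
    and d_t_mult: "d_t (\<lambda>q. f q * g q) p = d_t f p * g p + f p * d_t g p"
    and d_r_mult: "d_r (\<lambda>q. f q * g q) p = d_r f p * g p + f p * d_r g p"
proof -
  obtain t r where p: "p = (t, r)" by (cases p)
  note d = assms[unfolded p]
  note dt = d_t_real_derivative[OF d(1)] d_t_real_derivative[OF d(2)]
  note dr = d_r_real_derivative[OF d(1)] d_r_real_derivative[OF d(2)]
  show "d_t (\<lambda>q. f q + g q) p = d_t f p + d_t g p"
    unfolding p by (rule d_tI[OF DERIV_add[OF dt]])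
  show "d_r (\<lambda>q. f q + g q) p = d_r f p + d_r g p"
    unfolding p by (rule d_rI[OF DERIV_add[OF dr]])
  show "d_t (\<lambda>q. f q * g q) p = d_t f p * g p + f p * d_t g p"
    unfolding p by (rule trans[OF d_tI[OF DERIV_mult[OF dt]]]) simp
  show "d_r (\<lambda>q. f q * g q) p = d_r f p * g p + f p * d_r g p"
    unfolding p by (rule trans[OF d_rI[OF DERIV_mult[OF dr]]]) simp
qed

lemma d_const [simp]: "d_t (\<lambda>q. c) p = 0" "d_r (\<lambda>q. c) p = 0"
  by (cases p; simp add: d_t_def d_r_def)+

text \<open>On an open set, agreement extends along the coordinate lines through the point, and a
  derivative depends only on values nearby.\<close>

lemma
  assumes "open D" "p \<in> D" "\<And>q. q \<in> D \<Longrightarrow> f q = g q"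
  shows d_t_cong: "d_t f p = d_t g p" and d_r_cong: "d_r f p = d_r g p"
proof -
  obtain t r where p: "p = (t, r)" by (cases p)
  have "open ((\<lambda>s. (s, r)) -` D)" "open ((\<lambda>s. (t, s)) -` D)"
    using assms(1) by (auto intro!: open_vimage continuous_intros)
  then have "eventually (\<lambda>s. (s, r) \<in> D) (nhds t)" "eventually (\<lambda>s. (t, s) \<in> D) (nhds r)"
    using assms(2) unfolding p by (auto simp: eventually_nhds vimage_def)
  then show "d_t f p = d_t g p" "d_r f p = d_r g p"
    unfolding p d_t_def d_r_def prod.case
    by (auto intro!: deriv_cong_ev elim!: eventually_mono simp: assms(3))
qed

text \<open>The sum and product rules for \<open>d_t\<close> and \<open>d_r\<close> are available
  only at points of \<open>D\<close>, so the derivatives are replaced by their formulas on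
  \<open>D\<close> and regularity is transported back.\<close>

lemma C_times_cong:
  assumes "open D" "\<And>q. q \<in> D \<Longrightarrow> f q = g q" "C_times k D f"
  shows "C_times k D g"
  using assms(2,3)
proof (induction k arbitrary: f g)
  case 0
  then show ?case
    using continuous_on_cong[of D D f g] by simp
next
  case (Suc k)
  have "g differentiable (at p)" if p: "p \<in> D" for p
  proof -
    obtain f' where "(f has_derivative f') (at p)"
      using Suc.prems(2) p by (auto simp: differentiable_def)
    from has_derivative_transform_within_open[OF this assms(1) p Suc.prems(1)] show ?thesis
      unfolding differentiable_def by blast
  qed
  moreover have "C_times k D (d_t g)"
    using Suc.prems(2) by (intro Suc.IH[OF d_t_cong[OF assms(1) _ Suc.prems(1)]]) simp_all
  moreover have "C_times k D (d_r g)"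
    using Suc.prems(2) by (intro Suc.IH[OF d_r_cong[OF assms(1) _ Suc.prems(1)]]) simp_all
  ultimately show ?case by simp
qed

lemma C_times_SucD: "C_times (Suc k) D f \<Longrightarrow> C_times k D f"
proof (induction k arbitrary: f)
  case 0
  then show ?case
    by (auto intro!: continuous_at_imp_continuous_on differentiable_imp_continuous_within)
next
  case (Suc k)
  have "\<forall>p\<in>D. f differentiable (at p)" "C_times (Suc k) D (d_t f)" "C_times (Suc k) D (d_r f)"
    using Suc.prems unfolding C_times.simps(2)[of "Suc k"] by blast+
  from this(1) Suc.IH[OF this(2)] Suc.IH[OF this(3)] show ?case
    by simp
qed

lemma C_times_add:
  assumes "open D" "C_times k D f" "C_times k D g"
  shows "C_times k D (\<lambda>q. f q + g q)"
  using assms(2,3)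
proof (induction k arbitrary: f g)
  case 0
  then show ?case by (auto intro: continuous_on_add)
next
  case (Suc k)
  have "C_times k D (d_t (\<lambda>q. f q + g q))"
    by (rule C_times_cong[OF assms(1) _ Suc.IH[of "d_t f" "d_t g"]]) (use Suc.prems in \<open>auto simp: d_t_add\<close>)
  moreover have "C_times k D (d_r (\<lambda>q. f q + g q))"
    by (rule C_times_cong[OF assms(1) _ Suc.IH[of "d_r f" "d_r g"]]) (use Suc.prems in \<open>auto simp: d_r_add\<close>)
  ultimately show ?case
    using Suc.prems by (auto intro: differentiable_add)
qed

lemma C_times_mult:
  assumes "open D" "C_times k D f" "C_times k D g"
  shows "C_times k D (\<lambda>q. f q * g q)"
  using assms(2,3)
proof (induction k arbitrary: f g)
  case 0
  then show ?case by (auto intro: continuous_on_mult)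
next
  case (Suc k)
  \<comment> \<open>The Leibniz rule also contains the undifferentiated factors, which enter the
    induction hypothesis with order \<open>k\<close> only.\<close>
  note lower = Suc.prems[THEN C_times_SucD]
  have "C_times k D (\<lambda>q. d_t f q * g q + f q * d_t g q)" "C_times k D (\<lambda>q. d_r f q * g q + f q * d_r g q)"
    using Suc.prems lower by (auto intro!: C_times_add[OF assms(1)] Suc.IH)
  then have "C_times k D (d_t (\<lambda>q. f q * g q))" "C_times k D (d_r (\<lambda>q. f q * g q))"
    using Suc.prems by - (rule C_times_cong[OF assms(1), rotated], assumption, simp add: d_t_mult d_r_mult)+
  then show ?case
    using Suc.prems by (auto intro: differentiable_mult)
qed

lemma C_times_const: "C_times k D (\<lambda>q. c)"
proof (induction k arbitrary: c)
  case (Suc k)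
  have "d_t (\<lambda>q. c) = (\<lambda>q. 0)" "d_r (\<lambda>q. c) = (\<lambda>q. 0)"
    by auto
  then show ?case
    using Suc by simp
qed simp

lemma smooth_fun_add: "open D \<Longrightarrow> smooth_fun D f \<Longrightarrow> smooth_fun D g \<Longrightarrow> smooth_fun D (\<lambda>q. f q + g q)"
  by (simp add: smooth_fun_def C_times_add)

lemma smooth_fun_mult: "open D \<Longrightarrow> smooth_fun D f \<Longrightarrow> smooth_fun D g \<Longrightarrow> smooth_fun D (\<lambda>q. f q * g q)"
  by (simp add: smooth_fun_def C_times_mult)

lemma smooth_fun_const: "smooth_fun D (\<lambda>q. c)"
  by (simp add: smooth_fun_def C_times_const)

lemma smooth_fun_uminus: "open D \<Longrightarrow> smooth_fun D f \<Longrightarrow> smooth_fun D (\<lambda>q. - f q)"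
  using smooth_fun_mult[OF _ smooth_fun_const[of D "-1"], of f] by simp

lemma smooth_fun_diff: "open D \<Longrightarrow> smooth_fun D f \<Longrightarrow> smooth_fun D g \<Longrightarrow> smooth_fun D (\<lambda>q. f q - g q)"
  using smooth_fun_add[OF _ _ smooth_fun_uminus, of D f g] by simp

lemma smooth_fun_sum:
  "open D \<Longrightarrow> (\<And>i. i \<in> I \<Longrightarrow> smooth_fun D (f i)) \<Longrightarrow> smooth_fun D (\<lambda>q. \<Sum>i\<in>I. f i q)"
  by (induction I rule: infinite_finite_induct) (auto intro: smooth_fun_add smooth_fun_const)

lemma
  assumes "smooth_fun D f"
  shows smooth_fun_d_t: "smooth_fun D (d_t f)" and smooth_fun_d_r: "smooth_fun D (d_r f)"
    and smooth_fun_differentiable: "p \<in> D \<Longrightarrow> f differentiable (at p)"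
  using assms unfolding smooth_fun_def by (metis C_times.simps(2))+

lemma smooth_fun_snd: "smooth_fun D snd"
proof -
  have d: "d_t snd = (\<lambda>q. 0)" "d_r snd = (\<lambda>q. 1)"
    by (auto simp: d_t_def d_r_def)
  have "C_times k D snd" for k
    by (induction k)
       (auto simp: d C_times_const bounded_linear_snd bounded_linear_imp_differentiable intro!: continuous_intros)
  then show ?thesis
    by (simp add: smooth_fun_def)
qed

text \<open>Negative powers of t are singular on the line t = 0; removing it lets every integer
  \<open>n\<close> be treated on one domain.\<close>

abbreviation t_nonzero :: "(real \<times> real) set" where
  "t_nonzero \<equiv> {(t, r). t \<noteq> 0}"

lemma open_t_nonzero: "open t_nonzero"
proof -
  have "t_nonzero = fst -` (- {0})" by auto
  moreover have "open (fst -` (- {0::real}) :: (real \<times> real) set)"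
    by (intro open_vimage_fst open_Compl closed_singleton)
  ultimately show ?thesis by (simp only:)
qed

lemma d_powi:
  assumes "p \<in> t_nonzero"
  shows "d_t (\<lambda>q. fst q powi n) p = of_int n * fst p powi (n - 1)" "d_r (\<lambda>q. fst q powi n) p = 0"
  using assms by (auto intro!: d_tI d_rI derivative_eq_intros)

lemma smooth_fun_powi: "smooth_fun t_nonzero (\<lambda>q. fst q powi n)"
proof -
  \<comment> \<open>The exponent must vary in the induction, since \<open>d_t\<close> lowers it by
    one.\<close>
  have "C_times k t_nonzero (\<lambda>q. fst q powi n)" for k
  proof (induction k arbitrary: n)
    case 0
    then show ?case by (auto intro!: continuous_intros)
  next
    case (Suc k)
    have "C_times k t_nonzero (d_t (\<lambda>q. fst q powi n))"
      using C_times_cong[OF open_t_nonzero _ C_times_mult[OF open_t_nonzero C_times_const Suc]]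
      by (simp add: d_powi)
    moreover have "C_times k t_nonzero (d_r (\<lambda>q. fst q powi n))"
      using C_times_cong[OF open_t_nonzero _ C_times_const] by (simp add: d_powi)
    moreover have "(\<lambda>q::real \<times> real. fst q powi n) differentiable (at p)" if "p \<in> t_nonzero" for p
      using that by (intro differentiable_power_int) (auto simp: bounded_linear_fst bounded_linear_imp_differentiable)
    ultimately show ?case by simp
  qed
  then show ?thesis by (simp add: smooth_fun_def)
qed

text \<open>
  Both iterated mean value theorems evaluate the same second difference of \<open>f\<close> over a small
  square, so the two mixed derivatives agree at points arbitrarily close to \<open>p\<close>.
\<close>

lemma d_t_d_r_commute:
  assumes "open D" "p \<in> D" "C_times 2 D f"
  shows "d_t (d_r f) p = d_r (d_t f) p"
proof (rule ccontr)
  assume neq: "d_t (d_r f) p \<noteq> d_r (d_t f) p"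
  obtain t r where p: "p = (t, r)" by (cases p)
  have C2: "C_times (Suc (Suc 0)) D f"
    using assms(3) by (simp add: numeral_2_eq_2)
  have df: "f differentiable (at q)" "d_t f differentiable (at q)" "d_r f differentiable (at q)" if "q \<in> D" for q
    using C2 that by auto
  \<comment> \<open>Half the gap: values of the two mixed derivatives within \<open>e\<close> of
    their values at \<open>p\<close> can never coincide.\<close>
  define e where "e = \<bar>d_t (d_r f) p - d_r (d_t f) p\<bar> / 2"
  have "e > 0" using neq by (simp add: e_def)
  have "continuous_on D (d_t (d_r f))" "continuous_on D (d_r (d_t f))"
    using C2 by auto
  then have "isCont (d_t (d_r f)) p" "isCont (d_r (d_t f)) p"
    using assms(1,2) by (auto simp: continuous_on_eq_continuous_at)
  then obtain d1 d2 where d: "d1 > 0" "d2 > 0"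
    "\<And>q. dist q p < d1 \<Longrightarrow> dist (d_t (d_r f) q) (d_t (d_r f) p) < e"
    "\<And>q. dist q p < d2 \<Longrightarrow> dist (d_r (d_t f) q) (d_r (d_t f) p) < e"
    using \<open>e > 0\<close> unfolding continuous_at_eps_delta by metis
  obtain d3 where d3: "d3 > 0" "\<And>q. dist q p < d3 \<Longrightarrow> q \<in> D"
    using assms(1,2) by (meson open_dist)
  \<comment> \<open>Dividing by 3 puts the whole square of side \<open>h\<close>, whose points are
    within \<open>2 * h\<close> of \<open>p\<close>, inside all three balls.\<close>
  define h where "h = min d1 (min d2 d3) / 3"
  have h: "h > 0" "2 * h < d1" "2 * h < d2" "2 * h < d3"
    using d d3 by (auto simp: h_def)
  have near: "dist (s, u) p \<le> 2 * h" if "t \<le> s" "s \<le> t + h" "r \<le> u" "u \<le> r + h" for s u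
  proof -
    have "dist (s, u) p \<le> \<bar>s - t\<bar> + \<bar>u - r\<bar>"
      unfolding p dist_Pair_Pair dist_real_def
      using sqrt_sum_squares_le_sum_abs[of "\<bar>s - t\<bar>" "\<bar>u - r\<bar>"] by simp
    then show ?thesis using that by auto
  qed
  have inD: "(s, u) \<in> D" if "t \<le> s" "s \<le> t + h" "r \<le> u" "u \<le> r + h" for s u
    using near[OF that] h by (intro d3) auto
  define \<Delta> where "\<Delta> = f (t + h, r + h) - f (t + h, r) - f (t, r + h) + f (t, r)"
  obtain \<xi> where \<xi>: "t < \<xi>" "\<xi> < t + h"
    "\<Delta> = h * (d_t f (\<xi>, r + h) - d_t f (\<xi>, r))"
  proof -
    have "\<exists>z. t < z \<and> z < t + h \<and> (f (t + h, r + h) - f (t + h, r)) - (f (t, r + h) - f (t, r))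
        = (t + h - t) * (d_t f (z, r + h) - d_t f (z, r))"
      using h by (intro MVT2[where f = "\<lambda>s. f (s, r + h) - f (s, r)"] DERIV_diff d_t_real_derivative df inD) auto
    then show thesis using that unfolding \<Delta>_def by (auto simp: algebra_simps)
  qed
  obtain \<eta> where \<eta>: "r < \<eta>" "\<eta> < r + h" "d_t f (\<xi>, r + h) - d_t f (\<xi>, r) = (r + h - r) * d_r (d_t f) (\<xi>, \<eta>)"
    using h \<xi> MVT2[of r "r + h" "\<lambda>u. d_t f (\<xi>, u)" "\<lambda>u. d_r (d_t f) (\<xi>, u)"]
    by (metis d_r_real_derivative df(2) inD less_add_same_cancel1 less_imp_le)
  obtain \<eta>' where \<eta>': "r < \<eta>'" "\<eta>' < r + h"
    "\<Delta> = h * (d_r f (t + h, \<eta>') - d_r f (t, \<eta>'))"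
  proof -
    have "\<exists>z. r < z \<and> z < r + h \<and> (f (t + h, r + h) - f (t, r + h)) - (f (t + h, r) - f (t, r))
        = (r + h - r) * (d_r f (t + h, z) - d_r f (t, z))"
      using h by (intro MVT2[where f = "\<lambda>u. f (t + h, u) - f (t, u)"] DERIV_diff d_r_real_derivative df inD) auto
    then show thesis using that unfolding \<Delta>_def by (auto simp: algebra_simps)
  qed
  obtain \<xi>' where \<xi>': "t < \<xi>'" "\<xi>' < t + h" "d_r f (t + h, \<eta>') - d_r f (t, \<eta>') = (t + h - t) * d_t (d_r f) (\<xi>', \<eta>')"
    using h \<eta>' MVT2[of t "t + h" "\<lambda>s. d_r f (s, \<eta>')" "\<lambda>s. d_t (d_r f) (s, \<eta>')"]
    by (metis d_t_real_derivative df(3) inD less_add_same_cancel1 less_imp_le)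
  have "d_r (d_t f) (\<xi>, \<eta>) = d_t (d_r f) (\<xi>', \<eta>')"
    using \<xi>(3) \<eta>(3) \<eta>'(3) \<xi>'(3) h by simp
  moreover have "dist (d_r (d_t f) (\<xi>, \<eta>)) (d_r (d_t f) p) < e"
    using near[of \<xi> \<eta>] \<xi> \<eta> h by (intro d) auto
  moreover have "dist (d_t (d_r f) (\<xi>', \<eta>')) (d_t (d_r f) p) < e"
    using near[of \<xi>' \<eta>'] \<xi>' \<eta>' h by (intro d) auto
  ultimately show False
    unfolding dist_real_def e_def by (auto simp: abs_if split: if_splits)
qed

section \<open>Commutators of first-order operators\<close>

definition first_order_op ::
  "(real \<times> real \<Rightarrow> real) \<Rightarrow> (real \<times> real \<Rightarrow> real) \<Rightarrow> (real \<times> real \<Rightarrow> real) \<Rightarrow>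
   (real \<times> real \<Rightarrow> real) \<Rightarrow> real \<times> real \<Rightarrow> real" where
  "first_order_op \<alpha> \<beta> h f p = \<alpha> p * d_t f p + \<beta> p * d_r f p + h p * f p"

lemma smooth_fun_first_order_op:
  assumes "open D" "smooth_fun D \<alpha>" "smooth_fun D \<beta>" "smooth_fun D h" "smooth_fun D f"
  shows "smooth_fun D (first_order_op \<alpha> \<beta> h f)"
  unfolding first_order_op_def using assms
  by (intro smooth_fun_add smooth_fun_mult smooth_fun_d_t smooth_fun_d_r)

text \<open>The first two coefficients are the Lie bracket of the vector fields with components
  \<open>\<alpha>\<close>, \<open>\<beta>\<close> and \<open>\<alpha>'\<close>,
  \<open>\<beta>'\<close>. In the last one each field differentiates the multiplication term of the
  other operator, while the product of the two multiplication terms cancels.\<close>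

lemma first_order_op_commutator:
  assumes "open D" "p \<in> D" "smooth_fun D \<alpha>" "smooth_fun D \<beta>" "smooth_fun D h"
    "smooth_fun D \<alpha>'" "smooth_fun D \<beta>'" "smooth_fun D h'" "smooth_fun D f"
  shows "first_order_op \<alpha> \<beta> h (first_order_op \<alpha>' \<beta>' h' f) p - first_order_op \<alpha>' \<beta>' h' (first_order_op \<alpha> \<beta> h f) p =
    (\<alpha> p * d_t \<alpha>' p + \<beta> p * d_r \<alpha>' p - \<alpha>' p * d_t \<alpha> p - \<beta>' p * d_r \<alpha> p) * d_t f p
    + (\<alpha> p * d_t \<beta>' p + \<beta> p * d_r \<beta>' p - \<alpha>' p * d_t \<beta> p - \<beta>' p * d_r \<beta> p) * d_r f p
    + (\<alpha> p * d_t h' p + \<beta> p * d_r h' p - \<alpha>' p * d_t h p - \<beta>' p * d_r h p) * f p"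
proof -
  note diff = assms(3-9)[THEN smooth_fun_differentiable, OF assms(2)]
    smooth_fun_d_t[OF assms(9), THEN smooth_fun_differentiable, OF assms(2)]
    smooth_fun_d_r[OF assms(9), THEN smooth_fun_differentiable, OF assms(2)]
  \<comment> \<open>Generic coefficients allow one expansion to serve both orders of
    composition.\<close>
  have expand: "first_order_op a b k (first_order_op a' b' k' f) p =
    a p * (d_t a' p * d_t f p + a' p * d_t (d_t f) p + (d_t b' p * d_r f p + b' p * d_t (d_r f) p)
        + (d_t k' p * f p + k' p * d_t f p))
    + b p * (d_r a' p * d_t f p + a' p * d_r (d_t f) p + (d_r b' p * d_r f p + b' p * d_r (d_r f) p)
        + (d_r k' p * f p + k' p * d_r f p))
    + k p * (a' p * d_t f p + b' p * d_r f p + k' p * f p)"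
    if "a' differentiable (at p)" "b' differentiable (at p)" "k' differentiable (at p)" for a b k a' b' k'
    using that diff
    by (simp add: first_order_op_def[abs_def] d_t_add d_r_add d_t_mult d_r_mult differentiable_add differentiable_mult)
  have "d_t (d_r f) p = d_r (d_t f) p"
    using assms by (intro d_t_d_r_commute[of D]) (auto simp: smooth_fun_def)
  then show ?thesis
    unfolding expand[OF diff(1-3)] expand[OF diff(4-6)] by (simp add: algebra_simps)
qed

section \<open>The operators of the basis elements of W\<close>

fun coeff_t :: "W_basis \<Rightarrow> real \<times> real \<Rightarrow> real" where
  "coeff_t (W_L n) = (\<lambda>p. - (fst p powi (n + 1)))"
| "coeff_t (W_Leps n) = (\<lambda>p. 0)"

fun coeff_r :: "W_basis \<Rightarrow> real \<times> real \<Rightarrow> real" where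
  "coeff_r (W_L n) = (\<lambda>p. - (of_int (n + 1) * fst p powi n * snd p))"
| "coeff_r (W_Leps n) = (\<lambda>p. - (fst p powi (n + 1)))"

fun coeff_0 :: "real \<Rightarrow> real \<Rightarrow> W_basis \<Rightarrow> real \<times> real \<Rightarrow> real" where
  "coeff_0 x \<gamma> (W_L n) =
     (\<lambda>p. - (of_int (n + 1) * x * fst p powi n) - of_int (n * (n + 1)) * \<gamma> * fst p powi (n - 1) * snd p)"
| "coeff_0 x \<gamma> (W_Leps n) = (\<lambda>p. - (of_int (n + 1) * \<gamma> * fst p powi n))"

lemma W_op_first_order: "W_op x \<gamma> b = first_order_op (coeff_t b) (coeff_r b) (coeff_0 x \<gamma> b)"
proof (intro ext)
  fix f p
  show "W_op x \<gamma> b f p = first_order_op (coeff_t b) (coeff_r b) (coeff_0 x \<gamma> b) f p"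
    by (cases b; cases p) (simp_all add: first_order_op_def algebra_simps)
qed

lemmas smooth_intros = open_t_nonzero smooth_fun_add smooth_fun_diff smooth_fun_uminus smooth_fun_mult
  smooth_fun_const smooth_fun_powi smooth_fun_snd

lemma smooth_coeffs:
  "smooth_fun t_nonzero (coeff_t b)" "smooth_fun t_nonzero (coeff_r b)" "smooth_fun t_nonzero (coeff_0 x \<gamma> b)"
  by (cases b; simp only: coeff_t.simps coeff_r.simps coeff_0.simps; intro smooth_intros)+

lemma smooth_fun_W_op: "smooth_fun t_nonzero f \<Longrightarrow> smooth_fun t_nonzero (W_op x \<gamma> b f)"
  unfolding W_op_first_order
  by (intro smooth_fun_first_order_op open_t_nonzero smooth_coeffs)

lemma d_coeffs:
  assumes "t \<noteq> 0"
  shows "d_t (coeff_t (W_L n)) (t, r) = - (of_int (n + 1) * t powi n)"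
    "d_r (coeff_t (W_L n)) (t, r) = 0"
    "d_t (coeff_t (W_Leps n)) (t, r) = 0"
    "d_r (coeff_t (W_Leps n)) (t, r) = 0"
    "d_t (coeff_r (W_L n)) (t, r) = - (of_int (n + 1) * of_int n * t powi (n - 1) * r)"
    "d_r (coeff_r (W_L n)) (t, r) = - (of_int (n + 1) * t powi n)"
    "d_t (coeff_r (W_Leps n)) (t, r) = - (of_int (n + 1) * t powi n)"
    "d_r (coeff_r (W_Leps n)) (t, r) = 0"
    "d_t (coeff_0 x \<gamma> (W_L n)) (t, r) = - (of_int (n + 1) * x * of_int n * t powi (n - 1))
       - of_int (n * (n + 1)) * \<gamma> * of_int (n - 1) * t powi (n - 2) * r"
    "d_r (coeff_0 x \<gamma> (W_L n)) (t, r) = - (of_int (n * (n + 1)) * \<gamma> * t powi (n - 1))"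
    "d_t (coeff_0 x \<gamma> (W_Leps n)) (t, r) = - (of_int (n + 1) * \<gamma> * of_int n * t powi (n - 1))"
    "d_r (coeff_0 x \<gamma> (W_Leps n)) (t, r) = 0"
  using assms unfolding coeff_t.simps coeff_r.simps coeff_0.simps fst_conv snd_conv
  by (intro d_tI d_rI; auto intro!: derivative_eq_intros simp: algebra_simps)+

lemma W_op_commutator:
  assumes "p \<in> t_nonzero" "smooth_fun t_nonzero f"
  shows "W_op x \<gamma> b (W_op x \<gamma> b' f) p - W_op x \<gamma> b' (W_op x \<gamma> b f) p = W_rep x \<gamma> (W_table b b') f p"
proof -
  obtain t r where p: "p = (t, r)" and t: "t \<noteq> 0"
    using assms(1) by auto
  \<comment> \<open>Every power becomes a product of \<open>t powi n\<close>,
    \<open>t powi m\<close> and factors \<open>t\<close> or \<open>1 / t\<close>, so the comparison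
    of coefficients turns into rational arithmetic.\<close>
  have shift: "t powi (k + 1) = t powi k * t" "t powi (k - 1) = t powi k / t" "t powi (k - 2) = t powi k / (t * t)"
    "t powi (k + l) = t powi k * t powi l" for k l
    using t by (simp_all add: power_int_add power_int_diff power2_eq_square)
  have rep_scale: "W_rep x \<gamma> (s *\<^sub>R basis_vec b) f p = s * W_op x \<gamma> b f p"
    "W_rep x \<gamma> (- (s *\<^sub>R basis_vec b)) f p = - (s * W_op x \<gamma> b f p)" "W_rep x \<gamma> 0 f p = 0" for s b
    by (simp_all add: W_rep_def linear_scale[OF linear_lin_ext] linear_neg[OF linear_lin_ext] linear_0[OF linear_lin_ext])
  have comm: "W_op x \<gamma> b (W_op x \<gamma> b' f) p - W_op x \<gamma> b' (W_op x \<gamma> b f) p =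
    (coeff_t b p * d_t (coeff_t b') p + coeff_r b p * d_r (coeff_t b') p
      - coeff_t b' p * d_t (coeff_t b) p - coeff_r b' p * d_r (coeff_t b) p) * d_t f p
    + (coeff_t b p * d_t (coeff_r b') p + coeff_r b p * d_r (coeff_r b') p
      - coeff_t b' p * d_t (coeff_r b) p - coeff_r b' p * d_r (coeff_r b) p) * d_r f p
    + (coeff_t b p * d_t (coeff_0 x \<gamma> b') p + coeff_r b p * d_r (coeff_0 x \<gamma> b') p
      - coeff_t b' p * d_t (coeff_0 x \<gamma> b) p - coeff_r b' p * d_r (coeff_0 x \<gamma> b) p) * f p"
    unfolding W_op_first_order
    by (intro first_order_op_commutator[OF open_t_nonzero assms(1)] smooth_coeffs assms(2))
  show ?thesis
    unfolding comm
    \<comment> \<open>The derivatives are evaluated first, while the coefficient functions are still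
      folded as in \<open>d_coeffs\<close>; only then are these unfolded and compared.\<close>
    by (cases b; cases b')
       (simp_all only: p d_coeffs[OF t] W_table.simps rep_scale[unfolded p],
        simp_all only: coeff_t.simps coeff_r.simps coeff_0.simps W_op.simps fst_conv snd_conv shift,
        use t in \<open>simp_all add: field_simps\<close>)
qed

section \<open>Linear extension of the operators to W\<close>

lemma W_rep_basis_vec: "W_rep x \<gamma> (basis_vec b) = W_op x \<gamma> b"
  by (intro ext) (simp add: W_rep_def)

text \<open>An equation between functions, so that it can rewrite the argument of an outer
  operator.\<close>

lemma W_rep_lincomb: "W_rep x \<gamma> (u + s *\<^sub>R v) f = (\<lambda>q. W_rep x \<gamma> u f q + s * W_rep x \<gamma> v f q)"
  by (intro ext) (simp add: W_rep_def linear_add[OF linear_lin_ext] linear_scale[OF linear_lin_ext])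

lemma smooth_fun_W_rep:
  assumes "smooth_fun t_nonzero f"
  shows "smooth_fun t_nonzero (W_rep x \<gamma> u f)"
  unfolding W_rep_def[abs_def] lin_ext_def real_scaleR_def
  by (intro smooth_fun_sum smooth_intros smooth_fun_W_op assms)

lemma W_rep_cong:
  assumes "p \<in> t_nonzero" "\<And>q. q \<in> t_nonzero \<Longrightarrow> f q = g q"
  shows "W_rep x \<gamma> u f p = W_rep x \<gamma> u g p"
  using d_t_cong[OF open_t_nonzero assms] d_r_cong[OF open_t_nonzero assms] assms
  by (simp add: W_rep_def W_op_first_order first_order_op_def)

lemma W_rep_fun_lincomb:
  assumes "p \<in> t_nonzero" "smooth_fun t_nonzero f" "smooth_fun t_nonzero g"
  shows "W_rep x \<gamma> u (\<lambda>q. f q + s * g q) p = W_rep x \<gamma> u f p + s * W_rep x \<gamma> u g p"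
proof -
  note diff = assms(2,3)[THEN smooth_fun_differentiable, OF assms(1)]
  have "W_op x \<gamma> b (\<lambda>q. f q + s * g q) p = W_op x \<gamma> b f p + s *\<^sub>R W_op x \<gamma> b g p" for b
    unfolding W_op_first_order using diff
    by (simp add: first_order_op_def d_t_add d_r_add d_t_mult d_r_mult differentiable_mult algebra_simps)
  then show ?thesis
    by (simp add: W_rep_def lin_ext_add_fun lin_ext_scaleR_fun del: real_scaleR_def)
       (simp add: real_scaleR_def)
qed

text \<open>Both sides are bilinear in \<open>u\<close> and \<open>v\<close>, which reduces the
  identity to \<open>W_op_commutator\<close>.\<close>

lemma W_rep_bracket:
  assumes "p \<in> t_nonzero" "smooth_fun t_nonzero f"
  shows "W_rep x \<gamma> (W_bracket u v) f p = W_rep x \<gamma> u (W_rep x \<gamma> v f) p - W_rep x \<gamma> v (W_rep x \<gamma> u f) p"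
proof -
  define h where "h u v = W_rep x \<gamma> u (W_rep x \<gamma> v f) p - W_rep x \<gamma> v (W_rep x \<gamma> u f) p" for u v
  have lin: "linear g" if "\<And>u v s. g (u + s *\<^sub>R v) = g u + s * g v" for g :: "(W_basis \<Rightarrow>\<^sub>0 real) \<Rightarrow> real"
  proof (rule linearI)
    show add: "g (u + v) = g u + g v" for u v
      using that[of u 1 v] by simp
    have "g 0 = 0" using add[of 0 0] by simp
    then show "g (s *\<^sub>R v) = s *\<^sub>R g v" for s v
      using that[of 0 s v] by simp
  qed
  \<comment> \<open>In the compositions one of the vectors sits in the inner operator, so the outer
    operator must be linear in its function. That holds on smooth functions, hence the appeal to
    \<open>smooth_fun_W_rep\<close>.\<close>
  have "bilinear h"
    unfolding bilinear_def
    by (intro conjI allI lin; simp add: h_def W_rep_lincomb W_rep_fun_lincomb[OF assms(1)] smooth_fun_W_rep[OF assms(2)] algebra_simps)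
  have "bilinear (\<lambda>u v. W_rep x \<gamma> (W_bracket u v) f p)"
    unfolding bilinear_def
    by (intro conjI allI lin; simp add: bilinear_radd[OF bilinear_W_bracket] bilinear_ladd[OF bilinear_W_bracket]
        bilinear_rmul[OF bilinear_W_bracket] bilinear_lmul[OF bilinear_W_bracket] W_rep_lincomb)
  from this \<open>bilinear h\<close> have "W_rep x \<gamma> (W_bracket u v) f p = h u v"
    by (rule bilinear_eq_on_basis) (simp add: h_def W_rep_basis_vec W_op_commutator[OF assms])
  then show ?thesis
    by (simp add: h_def)
qed

lemma smooth_representation_W_rep: "smooth_representation t_nonzero W_bracket (W_rep x \<gamma>)"
  unfolding smooth_representation_def
proof (intro conjI allI impI ballI)
  show "W_rep x \<gamma> u f p = W_rep x \<gamma> u g p" if "\<forall>p\<in>t_nonzero. f p = g p" "p \<in> t_nonzero" for u f g p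
    using that by (intro W_rep_cong) blast+
qed (use open_t_nonzero lie_algebra_W_bracket in
  \<open>simp_all only: smooth_fun_W_rep W_rep_fun_lincomb W_rep_bracket W_rep_lincomb\<close>)

theorem proposition2p5:
  fixes c cbar x \<gamma> :: real
  shows "lie_subalgebra alt1 UNIV W_bracket \<and>
         lie_isomorphic alt1 W_bracket (sl2 \<times> sl2) (dual_bracket commutator) \<and>
         is_contraction (direct_sum_bracket (vir_bracket c) (vir_bracket cbar)) W_bracket \<and>
         smooth_representation {(t, r). t \<noteq> 0} W_bracket (W_rep x \<gamma>)"
  by (intro conjI lie_subalgebra_alt1 lie_isomorphic_alt1_sl2 is_contraction_vir_W smooth_representation_W_rep)

end
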